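(* Let $n \ge 1$ be an integer and let $$\overline{\zeta}_n(1,\ldots,1) = \sum_{\substack{a_1,\ldots,a_n \in \mathbb{Z}\setminus\{0\} \\ a_1+\cdots+a_n = 0}} \frac{1}{|a_1 a_2\cdots a_n|}.$$ Let $f(x) = \ln\binom{-2x}{-x}$, defined for real $x$ in a neighbourhood of $0$, and let $f^{(k)}(0)$ denote its $k$-th derivative at $x=0$. Then $$\overline{\zeta}_n(1,\ldots,1) = B_n\bigl(f^{(1)}(0),\ldots,f^{(n)}(0)\bigr),$$ where $B_n$ is the $n$-th complete exponential Bell polynomial. Additionally, $$\overline{\zeta}_n(1,\ldots,1) = B_n\bigl(0,\,(2^2-2)\Gamma(2)\zeta(2),\,\ldots,\,(2^n-2)\Gamma(n)\zeta(n)\bigr),$$ which is a polynomial with positive integer coefficients in the zeta values $\zeta(2),\ldots,\zeta(n)$; and equivalently $$\overline{\zeta}_n(1,\ldots,1) = B_n\bigl(0,\,2^2\Gamma(2)\eta(2),\,\ldots,\,2^n\Gamma(n)\eta(n)\bigr).$$ In the last two formulas the first argument of $B_n$ is $0$ and, for $2 \le k \le n$, the $k$-th argument is $(2^k-2)\Gamma(k)\zeta(k)$, respectively $2^k\Gamma(k)\eta(k)$.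
   Context: The symmetrized Mordell-Tornheim zeta function of depth $n \ge 1$ with positive integer parameters $w_1,\ldots,w_n \ge 1$ is $$\overline{\zeta}_n(w_1,\ldots,w_n) = \sum_{\substack{a_1,\ldots,a_n\in\mathbb{Z}\setminus\{0\}\\ a_1+\cdots+a_n=0}} \frac{1}{\left|a_1^{w_1}\cdots a_n^{w_n}\right|};$$ its weight is $w_1+\cdots+w_n$, and the theorem treats the case in which all $w_k=1$ (weight equal to depth). For $n=1$ the sum is empty and equals $0$. The complete exponential Bell polynomials $B_n$ are defined by the formal power series identity $$\exp\Bigl(\sum_{k=1}^{\infty} c_k \frac{x^k}{k!}\Bigr) = \sum_{n=0}^{\infty} B_n(c_1,\ldots,c_n)\frac{x^n}{n!}.$$ The generalized binomial coefficient is understood via the Gamma function: $\binom{-2x}{-x} = \frac{\Gamma(1-2x)}{\Gamma(1-x)^2}$, so $f(x) = \ln\frac{\Gamma(1-2x)}{\Gamma(1-x)^2}$ (defined and smooth for $|x|<\tfrac12$). $\zeta$ is the Riemann zeta function, $\Gamma$ is the Gamma function, and $\eta$ is the Dirichlet eta function $\eta(s)=\sum_{k\ge1} (-1)^{k-1}k^{-s}$, so that $2^k\eta(k) = (2^k-2)\zeta(k)$ for integers $k\ge2$. "A polynomial with positive integer coefficients in $\zeta(2),\ldots,\zeta(n)$" means: in the polynomial $B_n(0,(2^2-2)\Gamma(2)X_2,\ldots,(2^n-2)\Gamma(n)X_n)$ in indeterminates $X_2,\ldots,X_n$, every monomial that occurs has a positive integer coefficient (for $n=1$ this polynomial is $0$).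 *)

theory Defs
  imports "HOL-Analysis.Analysis" "HOL-Library.Poly_Mapping"
    "HOL-Computational_Algebra.Formal_Power_Series"
begin

definition MT_indices :: "nat \<Rightarrow> (nat \<Rightarrow> int) set" where
  "MT_indices n = {a \<in> {1..n} \<rightarrow>\<^sub>E - {0}. (\<Sum>k=1..n. a k) = 0}"

definition MT_term :: "nat \<Rightarrow> (nat \<Rightarrow> nat) \<Rightarrow> (nat \<Rightarrow> int) \<Rightarrow> real" where
  "MT_term n w a = 1 / \<bar>real_of_int (\<Prod>k=1..n. a k ^ w k)\<bar>"

(* The depth is n and the parameters are w 1, ..., w n.  As infsum is 0 on families that are not
   summable, equations about sym_MT_zeta are to be read together with summability of MT_term. *)
definition sym_MT_zeta :: "nat \<Rightarrow> (nat \<Rightarrow> nat) \<Rightarrow> real" where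
  "sym_MT_zeta n w = (\<Sum>\<^sub>\<infinity>a\<in>MT_indices n. MT_term n w a)"

definition Gamma_binomial :: "real \<Rightarrow> real \<Rightarrow> real" where
  "Gamma_binomial x y = Gamma (x + 1) / (Gamma (y + 1) * Gamma (x - y + 1))"

(* The series converges, and so defines the Riemann zeta function, for s > 1. *)
definition zeta :: "real \<Rightarrow> real" where
  "zeta s = suminf (\<lambda>j. 1 / real (Suc j) powr s)"

(* The series converges for s > 0; the index is shifted by one. *)
definition dirichlet_eta :: "real \<Rightarrow> real" where
  "dirichlet_eta s = suminf (\<lambda>j. (-1) ^ j / real (Suc j) powr s)"

text \<open>
  Polynomials over \<open>R\<close> in indeterminates indexed by \<open>nat\<close> are the finitely supported functions
  from monomials (exponent vectors \<open>nat \<Rightarrow>\<^sub>0 nat\<close>) to \<open>R\<close>, with convolution as multiplication.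
\<close>

type_synonym 'a mpoly = "(nat \<Rightarrow>\<^sub>0 nat) \<Rightarrow>\<^sub>0 'a"

definition mpoly_var :: "nat \<Rightarrow> 'a::zero_neq_one mpoly" where
  "mpoly_var i = Poly_Mapping.single (Poly_Mapping.single i 1) 1"

definition mpoly_eval :: "(nat \<Rightarrow> 'a) \<Rightarrow> 'a::comm_semiring_1 mpoly \<Rightarrow> 'a" where
  "mpoly_eval x p = (\<Sum>m\<in>Poly_Mapping.keys p. Poly_Mapping.lookup p m *
     (\<Prod>i\<in>Poly_Mapping.keys m. x i ^ Poly_Mapping.lookup m i))"

(* A real number acts on polynomials as multiplication by the corresponding constant polynomial. *)
instantiation poly_mapping ::
  (comm_monoid_add, "{comm_ring_1, real_algebra_1}") real_algebra_1
begin

definition scaleR_poly_mapping :: "real \<Rightarrow> ('a \<Rightarrow>\<^sub>0 'b) \<Rightarrow> ('a \<Rightarrow>\<^sub>0 'b)" where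
  "scaleR_poly_mapping r p = Poly_Mapping.single 0 (of_real r) * p"

instance
proof
  fix a b :: real and x y :: "'a \<Rightarrow>\<^sub>0 'b"
  show "a *\<^sub>R (x + y) = a *\<^sub>R x + a *\<^sub>R y"
    by (simp add: scaleR_poly_mapping_def distrib_left)
  show "(a + b) *\<^sub>R x = a *\<^sub>R x + b *\<^sub>R x"
    by (simp add: scaleR_poly_mapping_def single_add distrib_right)
  show "a *\<^sub>R b *\<^sub>R x = (a * b) *\<^sub>R x"
    by (simp add: scaleR_poly_mapping_def mult_single flip: mult.assoc)
  show "1 *\<^sub>R x = x"
    by (simp add: scaleR_poly_mapping_def)
  show "a *\<^sub>R x * y = a *\<^sub>R (x * y)"
    by (simp add: scaleR_poly_mapping_def mult.assoc)
  show "x * a *\<^sub>R y = a *\<^sub>R (x * y)"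
    by (simp add: scaleR_poly_mapping_def mult.left_commute)
qed

end

(* n! times the coefficient of x^n in exp (\<Sum>k\<ge>1. c k * x^k / k!).  The exponential series is
   written out, since fps_exp requires a field and the definition is also used over polynomial
   rings.  Only c 1, ..., c n contribute; the value c 0 is ignored. *)
definition complete_bell :: "nat \<Rightarrow> (nat \<Rightarrow> 'a::{comm_ring_1, real_algebra_1}) \<Rightarrow> 'a" where
  "complete_bell n c = fact n *
     fps_nth (fps_compose (Abs_fps (\<lambda>m. 1 /\<^sub>R fact m))
                          (Abs_fps (\<lambda>k. if k = 0 then 0 else c k /\<^sub>R fact k))) n"

definition zeta_bell_poly :: "nat \<Rightarrow> real mpoly" where
  "zeta_bell_poly n = complete_bell n
     (\<lambda>k. if k = 1 then 0 else ((2 ^ k - 2) * Gamma (real k)) *\<^sub>R mpoly_var k)"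

end

theory Submission
  imports Defs "HOL-Combinatorics.Stirling"
begin

text \<open>
  The coefficient of \<open>z\<^sup>N\<close> in \<open>(-ln (1 - z))\<^sup>p\<close> is the sum of \<open>1 / (a\<^sub>1 \<cdots> a\<^sub>p)\<close> over all positive
  tuples with sum \<open>N\<close>; it equals \<open>p! stirling N p / N!\<close>.  Splitting an index tuple into its positive and
  its negative part, whose sums are \<open>N\<close> and \<open>- N\<close>, hence gives, for the exponential generating function,
  \<open>\<Sum>\<^sub>n \<zeta>\<^sub>n x\<^sup>n / n! = \<Sum>\<^sub>N ((x)\<^sub>N / N!)\<^sup>2 = F(x, x; 1; 1)\<close>,
  where \<open>(x)\<^sub>N\<close> is the rising factorial.  By Gauss's summation theorem this is
  \<open>\<Gamma>(1 - 2x) / \<Gamma>(1 - x)\<^sup>2 = exp (f x)\<close>.  So the generating function solves \<open>H' = f' H\<close>, which is the recurrence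
  of the complete Bell polynomials in the derivatives of \<open>f\<close>; these are Polygamma values at 1.
\<close>

section \<open>Complete Bell polynomials and polynomial evaluation\<close>

text \<open>The coefficient of \<open>x^m\<close> in the equation expresses \<open>m + 1\<close>
  times coefficient \<open>m + 1\<close> through coefficients up to \<open>m\<close>. In
  characteristic zero the series is therefore determined by its constant term.\<close>

lemma fps_eqI_linear_ode:
  fixes F G D :: "'a::{idom, ring_char_0} fps"
  assumes "fps_deriv F = D * F" "fps_deriv G = D * G" "fps_nth F 0 = fps_nth G 0"
  shows "F = G"
proof (rule fps_ext)
  fix n show "fps_nth F n = fps_nth G n"
  proof (induction n rule: less_induct)
    case (less n)
    show ?case
    proof (cases n)
      case 0 then show ?thesis using assms(3) by simp
    next
      case (Suc m)
      have "of_nat (Suc m) * fps_nth F (Suc m) = fps_nth (D * F) m"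
        by (simp flip: assms(1) del: of_nat_Suc add: fps_deriv_nth)
      also have "\<dots> = fps_nth (D * G) m"
        unfolding fps_mult_nth using less Suc by (intro sum.cong) auto
      also have "\<dots> = of_nat (Suc m) * fps_nth G (Suc m)"
        by (simp flip: assms(2) del: of_nat_Suc add: fps_deriv_nth)
      finally show ?thesis using Suc by (simp del: of_nat_Suc)
    qed
  qed
qed

text \<open>The exponential generating function of the complete Bell polynomials.\<close>

definition bell_fps :: "(nat \<Rightarrow> 'a::{comm_ring_1, real_algebra_1}) \<Rightarrow> 'a fps" where
  "bell_fps c = fps_compose (Abs_fps (\<lambda>m. 1 /\<^sub>R fact m))
                          (Abs_fps (\<lambda>k. if k = 0 then 0 else c k /\<^sub>R fact k))"

lemma complete_bell_eq: "complete_bell n c = fact n * fps_nth (bell_fps c) n"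
  by (simp add: complete_bell_def bell_fps_def)

lemma complete_bell_0 [simp]: "complete_bell 0 c = 1"
  by (simp add: complete_bell_def)

lemma of_nat_Suc_scaleR_inverse_fact:
  "of_nat (Suc n) * (x /\<^sub>R fact (Suc n)) = (x::'a::real_algebra_1) /\<^sub>R fact n"
proof -
  have "of_nat (Suc n) * (x /\<^sub>R fact (Suc n)) = real (Suc n) *\<^sub>R (x /\<^sub>R fact (Suc n))"
    by (simp only: scaleR_conv_of_real of_real_of_nat_eq)
  then show ?thesis by (simp add: field_simps del: of_nat_Suc)
qed

text \<open>Chain rule: the exponential series is its own derivative, and differentiating the inner
  series shifts \<open>c\<close> by one.\<close>

lemma fps_deriv_bell_fps:
  fixes c :: "nat \<Rightarrow> 'a::{idom, real_algebra_1}"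
  shows "fps_deriv (bell_fps c) = Abs_fps (\<lambda>k. c (Suc k) /\<^sub>R fact k) * bell_fps c"
proof -
  have "fps_deriv (Abs_fps (\<lambda>m. (1::'a) /\<^sub>R fact m)) = Abs_fps (\<lambda>m. 1 /\<^sub>R fact m)"
    using of_nat_Suc_scaleR_inverse_fact[where x = "1::'a"]
    by (intro fps_ext) (simp del: of_nat_Suc fact_Suc)
  moreover have "fps_deriv (Abs_fps (\<lambda>k. if k = 0 then 0 else c k /\<^sub>R fact k))
      = Abs_fps (\<lambda>k. c (Suc k) /\<^sub>R fact k)"
    using of_nat_Suc_scaleR_inverse_fact[where 'a = 'a]
    by (intro fps_ext) (simp del: of_nat_Suc fact_Suc)
  ultimately show ?thesis
    unfolding bell_fps_def by (subst fps_compose_deriv) (simp_all add: mult.commute)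
qed

lemma fact_mult_scaleR_inverse: "fact k * (x /\<^sub>R fact k) = (x::'a::real_algebra_1)"
proof -
  have "fact k * (x /\<^sub>R fact k) = (fact k :: real) *\<^sub>R (x /\<^sub>R fact k)"
    by (simp only: scaleR_conv_of_real of_real_fact)
  then show ?thesis by simp
qed

text \<open>Coefficient \<open>n\<close> of the differential equation, multiplied by
  \<open>n!\<close>. The recurrence contains no division, so locality, compatibility with
  homomorphisms and integrality all follow from it by strong induction.\<close>

lemma complete_bell_Suc:
  fixes c :: "nat \<Rightarrow> 'a::{idom, real_algebra_1}"
  shows "complete_bell (Suc n) c
    = (\<Sum>k\<le>n. of_nat (n choose k) * c (Suc k) * complete_bell (n - k) c)"
proof -
  let ?B = "fps_nth (bell_fps c)"
  have "complete_bell (Suc n) c = fact n * (of_nat (Suc n) * ?B (Suc n))"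
    by (simp add: complete_bell_eq algebra_simps)
  also have "of_nat (Suc n) * ?B (Suc n) = fps_nth (fps_deriv (bell_fps c)) n"
    by simp
  also have "fact n * \<dots> = (\<Sum>k\<le>n. fact n * (c (Suc k) /\<^sub>R fact k * ?B (n - k)))"
    by (simp add: fps_deriv_bell_fps fps_mult_nth sum_distrib_left atMost_atLeast0)
  also have "\<dots> = (\<Sum>k\<le>n. of_nat (n choose k) * c (Suc k) * complete_bell (n - k) c)"
  proof (rule sum.cong)
    fix k assume "k \<in> {..n}"
    \<comment> \<open>In a general ring one cannot divide by factorials, so \<open>n!\<close> is
      split as a product that absorbs both denominators.\<close>
    then have "of_nat (fact k * fact (n - k) * (n choose k)) = (of_nat (fact n) :: 'a)"
      by (subst binomial_fact_lemma) simp_all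
    then have "fact n = (fact k * fact (n - k) * of_nat (n choose k) :: 'a)"
      by simp
    then have "fact n * (c (Suc k) /\<^sub>R fact k * ?B (n - k)) =
        fact k * fact (n - k) * of_nat (n choose k) * (c (Suc k) /\<^sub>R fact k * ?B (n - k))"
      by (rule arg_cong)
    also have "\<dots> =
        of_nat (n choose k) * (fact k * (c (Suc k) /\<^sub>R fact k)) * (fact (n - k) * ?B (n - k))"
      by (simp only: mult_ac)
    also have "\<dots> = of_nat (n choose k) * c (Suc k) * complete_bell (n - k) c"
      by (simp only: fact_mult_scaleR_inverse complete_bell_eq)
    finally show "fact n * (c (Suc k) /\<^sub>R fact k * ?B (n - k)) =
       of_nat (n choose k) * c (Suc k) * complete_bell (n - k) c" .
  qed simp
  finally show ?thesis .
qed

lemma complete_bell_cong: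
  fixes c d :: "nat \<Rightarrow> 'a::{idom, real_algebra_1}"
  assumes "\<And>k. 1 \<le> k \<Longrightarrow> k \<le> n \<Longrightarrow> c k = d k"
  shows "complete_bell n c = complete_bell n d"
  using assms
proof (induction n rule: less_induct)
  case (less n)
  then show ?case
    by (cases n) (auto simp: complete_bell_Suc intro!: sum.cong)
qed

text \<open>The recurrence uses only sums, products and natural numbers, which a unital ring
  homomorphism preserves. It is applied to evaluation of polynomials.\<close>

lemma complete_bell_hom:
  fixes c :: "nat \<Rightarrow> 'a::{idom, real_algebra_1}" and \<phi> :: "'a \<Rightarrow> 'b::{idom, real_algebra_1}"
  assumes add: "\<And>x y. \<phi> (x + y) = \<phi> x + \<phi> y" and mult: "\<And>x y. \<phi> (x * y) = \<phi> x * \<phi> y"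
    and one: "\<phi> 1 = 1"
  shows "\<phi> (complete_bell n c) = complete_bell n (\<lambda>k. \<phi> (c k))"
proof -
  have zero: "\<phi> 0 = 0" using add[of 0 0] by simp
  have nat: "\<phi> (of_nat k) = of_nat k" for k
    by (induction k) (simp_all add: zero add one)
  have sum: "\<phi> (\<Sum>k\<in>K. h k) = (\<Sum>k\<in>K. \<phi> (h k))" for h :: "nat \<Rightarrow> 'a" and K
    by (induction K rule: infinite_finite_induct) (simp_all add: zero add)
  show ?thesis
  proof (induction n rule: less_induct)
    case (less n)
    then show ?case
      by (cases n) (auto simp: complete_bell_Suc sum mult nat one intro!: sum.cong)
  qed
qed

text \<open>\<open>D\<close> is the logarithmic derivative of \<open>F\<close>. Thus a generating
  function is recognised as one of Bell polynomials without forming its logarithm as a power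
  series.\<close>

lemma complete_bell_eqI:
  fixes F :: "real fps"
  assumes "fps_nth F 0 = 1" "fps_deriv F = D * F" "\<And>k. fps_nth D k = c (Suc k) / fact k"
  shows "complete_bell n c = fact n * fps_nth F n"
proof -
  have D: "Abs_fps (\<lambda>k. c (Suc k) /\<^sub>R fact k) = D"
    by (rule fps_ext) (simp add: assms(3) divide_inverse mult.commute)
  have "bell_fps c = F"
  proof (rule fps_eqI_linear_ode)
    show "fps_deriv (bell_fps c) = D * bell_fps c" using fps_deriv_bell_fps[of c] by (simp only: D)
    show "fps_nth (bell_fps c) 0 = fps_nth F 0"
      using complete_bell_0[of c] assms(1) by (simp add: complete_bell_eq)
  qed (rule assms(2))
  then show ?thesis by (simp add: complete_bell_eq)
qed

section \<open>Evaluation of polynomials as a ring homomorphism\<close>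

lemma mpoly_eval_superset:
  assumes "finite S" "Poly_Mapping.keys p \<subseteq> S"
  shows "mpoly_eval x p = (\<Sum>m\<in>S. Poly_Mapping.lookup p m *
     (\<Prod>i\<in>Poly_Mapping.keys m. x i ^ Poly_Mapping.lookup m i))"
  unfolding mpoly_eval_def using assms
  by (intro sum.mono_neutral_left) (auto simp: in_keys_iff)

lemma mpoly_eval_add: "mpoly_eval x (p + q) = mpoly_eval x p + mpoly_eval x q"
proof -
  let ?S = "Poly_Mapping.keys p \<union> Poly_Mapping.keys q"
  have "finite ?S" by simp
  note eq = mpoly_eval_superset[OF this, of _ x]
  show ?thesis
    unfolding eq[OF keys_add] eq[OF Un_upper1] eq[OF Un_upper2] lookup_add distrib_right sum.distrib ..
qed

lemma mpoly_eval_single: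
  "mpoly_eval x (Poly_Mapping.single m a) =
     a * (\<Prod>i\<in>Poly_Mapping.keys m. x i ^ Poly_Mapping.lookup m i)"
  \<comment> \<open>Summing over \<open>{m}\<close> also covers \<open>a = 0\<close>, where the
    polynomial has no keys.\<close>
  by (subst mpoly_eval_superset[of "{m}"]) auto

lemma mpoly_eval_0 [simp]: "mpoly_eval x 0 = 0"
  by (simp add: mpoly_eval_def)

lemma mpoly_eval_1 [simp]: "mpoly_eval x 1 = 1"
  by (simp add: mpoly_eval_single flip: single_one)

lemma prod_power_keys_add:
  fixes x :: "nat \<Rightarrow> 'a::comm_semiring_1" and m m' :: "nat \<Rightarrow>\<^sub>0 nat"
  shows "(\<Prod>i\<in>Poly_Mapping.keys (m + m'). x i ^ Poly_Mapping.lookup (m + m') i) =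
    (\<Prod>i\<in>Poly_Mapping.keys m. x i ^ Poly_Mapping.lookup m i) *
    (\<Prod>i\<in>Poly_Mapping.keys m'. x i ^ Poly_Mapping.lookup m' i)"
proof -
  let ?S = "Poly_Mapping.keys m \<union> Poly_Mapping.keys m'"
  have *: "(\<Prod>i\<in>Poly_Mapping.keys l. x i ^ Poly_Mapping.lookup l i) =
      (\<Prod>i\<in>?S. x i ^ Poly_Mapping.lookup l i)" if "Poly_Mapping.keys l \<subseteq> ?S" for l
    using that by (intro prod.mono_neutral_left) (auto simp: in_keys_iff)
  show ?thesis
    unfolding *[OF keys_add] *[OF Un_upper1] *[OF Un_upper2]
    by (simp add: lookup_add power_add prod.distrib)
qed

lemma poly_mapping_induct_single_add [case_names zero add]:
  assumes "P 0" and "\<And>m a p. P p \<Longrightarrow> P (Poly_Mapping.single m a + p)"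
  shows "P p"
proof (induction p rule: update_induct)
  case const then show ?case by (rule assms(1))
next
  case (update p m a)
  \<comment> \<open>The updated position is not yet a key of \<open>p\<close>, so overwriting it
    amounts to adding a monomial.\<close>
  have "Poly_Mapping.update m a p = Poly_Mapping.single m a + p"
    using update by (intro poly_mapping_eqI) (auto simp: lookup_update lookup_add lookup_single in_keys_iff when_def)
  then show ?case using assms(2) update by simp
qed

text \<open>Both sides are additive in \<open>p\<close> and in \<open>q\<close>, which reduces the
  claim to two monomials, where exponents add.\<close>

lemma mpoly_eval_mult: "mpoly_eval x (p * q) = mpoly_eval x p * mpoly_eval x q"
proof (induction p rule: poly_mapping_induct_single_add)
  case zero then show ?case by simp
next
  case (add m a p)
  have "mpoly_eval x (Poly_Mapping.single m a * q) = mpoly_eval x (Poly_Mapping.single m a) * mpoly_eval x q"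
  proof (induction q rule: poly_mapping_induct_single_add)
    case zero then show ?case by simp
  next
    case (add m' b q)
    then show ?case
      by (simp add: distrib_left mpoly_eval_add mult_single mpoly_eval_single prod_power_keys_add mult_ac)
  qed
  then show ?case using add by (simp add: distrib_right mpoly_eval_add)
qed

lemma mpoly_eval_scaleR: "mpoly_eval x (a *\<^sub>R p) = a * mpoly_eval x p" for x :: "nat \<Rightarrow> real"
  by (simp add: scaleR_poly_mapping_def mpoly_eval_mult mpoly_eval_single)

lemma mpoly_eval_var: "mpoly_eval x (mpoly_var i) = x i"
  by (simp add: mpoly_var_def mpoly_eval_single)

lemma mpoly_eval_zeta_bell_poly:
  "mpoly_eval x (zeta_bell_poly n) =
     complete_bell n (\<lambda>k. if k = 1 then 0 else (2 ^ k - 2) * Gamma (real k) * x k)"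
proof -
  have "(\<lambda>k. mpoly_eval x (if k = 1 then 0 else ((2 ^ k - 2) * Gamma (real k)) *\<^sub>R mpoly_var k))
      = (\<lambda>k. if k = 1 then 0 else (2 ^ k - 2) * Gamma (real k) * x k)"
    by (auto simp: fun_eq_iff mpoly_eval_scaleR mpoly_eval_var)
  then show ?thesis
    unfolding zeta_bell_poly_def
    by (subst complete_bell_hom[where \<phi> = "mpoly_eval x"]) (simp_all add: mpoly_eval_add mpoly_eval_mult)
qed

section \<open>Polynomials with natural number coefficients\<close>

definition nonneg_int_mpoly :: "nat set \<Rightarrow> real mpoly \<Rightarrow> bool" where
  "nonneg_int_mpoly V p \<longleftrightarrow>
     (\<forall>m. Poly_Mapping.lookup p m \<in> \<nat>) \<and> (\<forall>m\<in>Poly_Mapping.keys p. Poly_Mapping.keys m \<subseteq> V)"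

lemma nonneg_int_mpoly_0 [simp]: "nonneg_int_mpoly V 0"
  by (simp add: nonneg_int_mpoly_def)

lemma nonneg_int_mpoly_add:
  "nonneg_int_mpoly V p \<Longrightarrow> nonneg_int_mpoly V q \<Longrightarrow> nonneg_int_mpoly V (p + q)"
  using keys_add[of p q] unfolding nonneg_int_mpoly_def lookup_add by (blast intro: Nats_add)

lemma nonneg_int_mpoly_single:
  "a \<in> \<nat> \<Longrightarrow> Poly_Mapping.keys m \<subseteq> V \<Longrightarrow> nonneg_int_mpoly V (Poly_Mapping.single m a)"
  by (auto simp: nonneg_int_mpoly_def lookup_single when_def)

lemma nonneg_int_mpoly_sum:
  "(\<And>k. k \<in> K \<Longrightarrow> nonneg_int_mpoly V (h k)) \<Longrightarrow> nonneg_int_mpoly V (sum h K)"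
  by (induction K rule: infinite_finite_induct) (auto intro: nonneg_int_mpoly_add)

lemma nonneg_int_mpoly_mult:
  assumes "nonneg_int_mpoly V p" "nonneg_int_mpoly V q"
  shows "nonneg_int_mpoly V (p * q)"
proof -
  \<comment> \<open>Writing both factors as sums of monomials turns the convolution into a double
    sum of monomials with visible coefficients.\<close>
  have dec: "r = (\<Sum>m\<in>Poly_Mapping.keys r. Poly_Mapping.single m (Poly_Mapping.lookup r m))" for r :: "real mpoly"
    by (intro poly_mapping_eqI) (auto simp: lookup_sum lookup_single when_def in_keys_iff sum.delta)
  have "p * q = (\<Sum>m\<in>Poly_Mapping.keys p. \<Sum>m'\<in>Poly_Mapping.keys q.
      Poly_Mapping.single (m + m') (Poly_Mapping.lookup p m * Poly_Mapping.lookup q m'))"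
    by (subst dec[of p], subst dec[of q]) (simp add: sum_product mult_single)
  moreover have "nonneg_int_mpoly V \<dots>"
  proof (intro nonneg_int_mpoly_sum nonneg_int_mpoly_single)
    fix m m' assume "m \<in> Poly_Mapping.keys p" "m' \<in> Poly_Mapping.keys q"
    then show "Poly_Mapping.lookup p m * Poly_Mapping.lookup q m' \<in> \<nat>"
      and "Poly_Mapping.keys (m + m') \<subseteq> V"
      using assms keys_add[of m m'] by (fastforce simp: nonneg_int_mpoly_def intro!: Nats_mult)+
  qed
  ultimately show ?thesis by simp
qed

lemma nonneg_int_mpoly_complete_bell:
  assumes "\<And>k. 1 \<le> k \<Longrightarrow> k \<le> n \<Longrightarrow> nonneg_int_mpoly V (c k)"
  shows "nonneg_int_mpoly V (complete_bell n c)"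
  using assms
proof (induction n rule: less_induct)
  case (less n)
  have nat: "nonneg_int_mpoly V (of_nat j)" for j
    by (simp add: nonneg_int_mpoly_single flip: single_of_nat)
  show ?case
  proof (cases n)
    case 0
    then show ?thesis using nat[of 1] by simp
  next
    case (Suc l)
    then show ?thesis using less
      by (auto simp: complete_bell_Suc intro!: nonneg_int_mpoly_sum nonneg_int_mpoly_mult nat)
  qed
qed

lemma two_power_diff_mult_Gamma_Nats:
  assumes "k \<ge> 1" shows "(2 ^ k - 2) * Gamma (real k) \<in> \<nat>"
proof -
  have "(2::nat) \<le> 2 ^ k" using assms self_le_power[of 2 k] by simp
  then have "(2 ^ k - 2) * Gamma (real k) = real ((2 ^ k - 2) * fact (k - 1))"
    using assms Gamma_fact[of "k - 1", where 'a = real] by (simp add: of_nat_diff add.commute)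
  then show ?thesis by (metis of_nat_in_Nats)
qed

lemma zeta_bell_poly_coeffs:
  "nonneg_int_mpoly {2..n} (zeta_bell_poly n)"
  unfolding zeta_bell_poly_def
proof (rule nonneg_int_mpoly_complete_bell)
  fix k assume k: "1 \<le> k" "k \<le> n"
  show "nonneg_int_mpoly {2..n}
    (if k = 1 then 0 else ((2 ^ k - 2) * Gamma (real k)) *\<^sub>R mpoly_var k)"
  proof (cases "k = 1")
    case False
    have "nonneg_int_mpoly {2..n} (((2 ^ k - 2) * Gamma (real k)) *\<^sub>R mpoly_var k)"
      unfolding scaleR_poly_mapping_def mpoly_var_def of_real_eq_id id_apply
      using k False two_power_diff_mult_Gamma_Nats[OF k(1)]
      by (intro nonneg_int_mpoly_mult nonneg_int_mpoly_single) simp_all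
    with False show ?thesis by simp
  qed simp
qed

section \<open>Index tuples with a given sum of positive parts\<close>

text \<open>The index set is arbitrary because it will be the set of positive positions, or of
  negative positions, of an index tuple.\<close>

definition positive_tuples :: "'a set \<Rightarrow> nat \<Rightarrow> ('a \<Rightarrow> nat) set" where
  "positive_tuples B N = {u \<in> B \<rightarrow>\<^sub>E {0<..}. sum u B = N}"

lemma finite_positive_tuples:
  assumes "finite B" shows "finite (positive_tuples B N)"
proof (rule finite_subset)
  show "positive_tuples B N \<subseteq> B \<rightarrow>\<^sub>E {..N}"
    using assms by (auto simp: positive_tuples_def PiE_iff extensional_def intro!: member_le_sum)
qed (use assms in \<open>auto intro: finite_PiE\<close>)

(* -ln (1 - z); the constant coefficient is 1 / 0 = 0. *)
definition log_fps :: "real fps" where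
  "log_fps = Abs_fps (\<lambda>n. 1 / real n)"

lemma fps_deriv_log_fps: "(1 - fps_X) * fps_deriv log_fps = 1"
proof (rule fps_ext)
  fix n show "fps_nth ((1 - fps_X) * fps_deriv log_fps) n = fps_nth 1 n"
    by (cases n) (simp_all add: log_fps_def left_diff_distrib)
qed

text \<open>With \<open>L = log_fps\<close>, \<open>(1 - z) (L^(p+1))' = (p + 1) L^p\<close>. By the
  recurrence of the unsigned Stirling numbers of the first kind, the series on the right satisfies
  the same relation, and both constant terms vanish for positive exponents.\<close>

lemma log_fps_power: "log_fps ^ p = Abs_fps (\<lambda>N. fact p * real (stirling N p) / fact N)"
proof (induction p)
  case 0
  show ?case by (rule fps_ext) (auto simp: neq0_conv)
next
  case (Suc p)
  let ?S = "\<lambda>p. Abs_fps (\<lambda>N. fact p * real (stirling N p) / fact N)"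
  have "fps_nth ((1 - fps_X) * fps_deriv (?S (Suc p))) N = fps_nth (of_nat (Suc p) * ?S p) N" for N
  proof (cases N)
    case 0
    then show ?thesis
      by (cases p) (simp_all add: left_diff_distrib fps_mult_of_nat_nth)
  next
    case (Suc M)
    have "fps_nth ((1 - fps_X) * fps_deriv (?S (Suc p))) N
      = real (Suc N) * (fact (Suc p) * real (stirling (Suc N) (Suc p)) / fact (Suc N))
        - real N * (fact (Suc p) * real (stirling N (Suc p)) / fact N)"
      using Suc by (simp add: left_diff_distrib)
    also have "real (Suc N) * (fact (Suc p) * real (stirling (Suc N) (Suc p)) / fact (Suc N))
      = fact (Suc p) * real (stirling (Suc N) (Suc p)) / fact N"
      by (simp add: field_simps del: stirling.simps of_nat_Suc)
    finally show ?thesis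
      by (simp add: fps_mult_of_nat_nth field_simps)
  qed
  then have S: "(1 - fps_X) * fps_deriv (?S (Suc p)) = of_nat (Suc p) * ?S p"
    by (rule fps_ext)
  have "(1 - fps_X) * fps_deriv (log_fps ^ Suc p)
      = of_nat (Suc p) * log_fps ^ p * ((1 - fps_X) * fps_deriv log_fps)"
    by (simp only: fps_deriv_power diff_Suc_1 fps_of_nat mult_ac)
  \<comment> \<open>Cancelling \<open>1 - fps_X\<close> shows that the derivatives agree; the series
    then differ by a constant, which is zero.\<close>
  then have "(1 - fps_X) * fps_deriv (log_fps ^ Suc p) = (1 - fps_X) * fps_deriv (?S (Suc p))"
    by (simp only: fps_deriv_log_fps S Suc.IH mult_1_right)
  then have "(1 - fps_X) * (fps_deriv (log_fps ^ Suc p) - fps_deriv (?S (Suc p))) = 0"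
    by (simp only: right_diff_distrib diff_self)
  moreover have "1 - fps_X \<noteq> (0 :: real fps)"
    by (metis eq_iff_diff_eq_0 fps_one_nth fps_X_nth zero_neq_one)
  ultimately have "fps_deriv (log_fps ^ Suc p) = fps_deriv (?S (Suc p))"
    using mult_eq_0_iff right_minus_eq by blast
  then have "log_fps ^ Suc p = ?S (Suc p)
      + fps_const (fps_nth (log_fps ^ Suc p) 0 - fps_nth (?S (Suc p)) 0)"
    by (simp only: fps_deriv_eq_iff add.commute)
  then show ?case by (simp add: log_fps_def fps_nth_power_0)
qed

lemma positive_tuples_insert:
  assumes "finite B" "b \<notin> B"
  shows "(\<Sum>u\<in>positive_tuples (insert b B) N. \<Prod>k\<in>insert b B. 1 / real (u k)) =
    (\<Sum>j=1..N. 1 / real j * (\<Sum>u\<in>positive_tuples B (N - j). \<Prod>k\<in>B. 1 / real (u k)))"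
proof -
  have "(\<Sum>u\<in>positive_tuples (insert b B) N. \<Prod>k\<in>insert b B. 1 / real (u k)) =
    (\<Sum>(j,u)\<in>Sigma {1..N} (\<lambda>j. positive_tuples B (N - j)). 1 / real j * (\<Prod>k\<in>B. 1 / real (u k)))"
  \<comment> \<open>The value \<open>j\<close> at \<open>b\<close> is split off. Resetting it to
    \<open>undefined\<close> makes the remaining tuple extensional on \<open>B\<close>.\<close>
  proof (rule sum.reindex_bij_witness[where i = "\<lambda>(j,u). u(b := j)" and j = "\<lambda>u. (u b, u(b := undefined))"])
    fix u assume u: "u \<in> positive_tuples (insert b B) N"
    then have "(\<Sum>k\<in>B. (u(b := undefined)) k) = N - u b"
      using assms by (auto simp: positive_tuples_def intro!: sum.cong)
    moreover have "u b \<in> {1..N}"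
      using u assms by (auto simp: positive_tuples_def PiE_iff)
    moreover have "u(b := undefined) \<in> B \<rightarrow>\<^sub>E {0<..}"
      using u assms by (auto simp: positive_tuples_def PiE_iff extensional_def)
    ultimately show "(u b, u(b := undefined)) \<in> Sigma {1..N} (\<lambda>j. positive_tuples B (N - j))"
      by (simp add: positive_tuples_def)
    have "(\<Prod>k\<in>B. 1 / real (u k)) = (\<Prod>k\<in>B. 1 / real ((u(b := undefined)) k))"
      using assms by (intro prod.cong) auto
    then show "(case (u b, u(b := undefined)) of (j, u) \<Rightarrow> 1 / real j * (\<Prod>k\<in>B. 1 / real (u k)))
      = (\<Prod>k\<in>insert b B. 1 / real (u k))"
      using assms by simp
  next
    fix ju assume "ju \<in> Sigma {1..N} (\<lambda>j. positive_tuples B (N - j))"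
    then obtain j u where ju: "ju = (j, u)" "j \<in> {1..N}" "u \<in> positive_tuples B (N - j)" by auto
    have "(\<Sum>k\<in>B. (u(b := j)) k) = sum u B"
      using assms by (intro sum.cong) auto
    then show "(case ju of (j, u) \<Rightarrow> u(b := j)) \<in> positive_tuples (insert b B) N"
      using ju assms by (auto simp: positive_tuples_def PiE_iff extensional_def)
    show "((case ju of (j, u) \<Rightarrow> u(b := j)) b, (case ju of (j, u) \<Rightarrow> u(b := j))(b := undefined)) = ju"
      using ju assms by (auto simp: positive_tuples_def PiE_iff extensional_def fun_eq_iff)
  qed auto
  also have "\<dots> = (\<Sum>j=1..N. 1 / real j * (\<Sum>u\<in>positive_tuples B (N - j). \<Prod>k\<in>B. 1 / real (u k)))"
    using assms by (subst sum.Sigma[symmetric]) (auto simp: finite_positive_tuples sum_distrib_left)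
  finally show ?thesis .
qed

text \<open>Each further index convolves with the coefficients \<open>1 / j\<close> of
  \<open>log_fps\<close>, so the sum is a coefficient of a power of it.\<close>

lemma sum_positive_tuples:
  assumes "finite B"
  shows "(\<Sum>u\<in>positive_tuples B N. \<Prod>k\<in>B. 1 / real (u k)) =
    fact (card B) * real (stirling N (card B)) / fact N"
proof -
  have "(\<Sum>u\<in>positive_tuples B N. \<Prod>k\<in>B. 1 / real (u k)) = fps_nth (log_fps ^ card B) N"
    using assms
  proof (induction B arbitrary: N rule: finite_induct)
    case empty
    then show ?case
      by (cases "N = 0") (auto simp: positive_tuples_def)
  next
    case (insert b B)
    then have "(\<Sum>u\<in>positive_tuples (insert b B) N. \<Prod>k\<in>insert b B. 1 / real (u k))
      = (\<Sum>j=1..N. fps_nth log_fps j * fps_nth (log_fps ^ card B) (N - j))"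
      by (subst positive_tuples_insert) (auto simp: log_fps_def)
    \<comment> \<open>The added term \<open>j = 0\<close> vanishes because
      \<open>1 / 0 = 0\<close>.\<close>
    also have "\<dots> = (\<Sum>j=0..N. fps_nth log_fps j * fps_nth (log_fps ^ card B) (N - j))"
      by (intro sum.mono_neutral_left) (auto simp: log_fps_def not_le)
    finally show ?case using insert by (simp add: fps_mult_nth)
  qed
  then show ?thesis by (simp add: log_fps_power)
qed

text \<open>Since the whole sum is zero, the negative entries of a tuple in the slice sum to
  \<open>- N\<close>. This makes every slice finite.\<close>

definition MT_slice :: "nat \<Rightarrow> nat \<Rightarrow> (nat \<Rightarrow> int) set" where
  "MT_slice n N = {a \<in> MT_indices n. (\<Sum>k | k \<in> {1..n} \<and> a k > 0. a k) = int N}"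

text \<open>An index tuple is the set \<open>A\<close> of its positive positions together with the
  absolute values on \<open>A\<close> and on its complement. The map \<open>i\<close> glues these
  data.\<close>

lemma bij_betw_MT_slice:
  fixes n N :: nat
  defines "T \<equiv> Sigma (Pow {1..n}) (\<lambda>A. positive_tuples A N \<times> positive_tuples ({1..n} - A) N)"
    and "i \<equiv> \<lambda>(A, u, v). (\<lambda>k. if k \<in> A then int (u k) else if k \<in> {1..n} then - int (v k) else undefined)"
  shows "bij_betw i T (MT_slice n N)"
proof -
  \<comment> \<open>The inverse of \<open>i\<close>: it reads off the positive positions and the two
    tuples of absolute values.\<close>
  define j :: "(nat \<Rightarrow> int) \<Rightarrow> _" where "j = (\<lambda>a. let A = {k \<in> {1..n}. a k > 0} in
     (A, restrict (\<lambda>k. nat (a k)) A, restrict (\<lambda>k. nat (- a k)) ({1..n} - A)))"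
  have split: "(\<Sum>k=1..n. h k) = (\<Sum>k\<in>A. h k) + (\<Sum>k\<in>{1..n} - A. h k)" if "A \<subseteq> {1..n}" for A and h :: "nat \<Rightarrow> int"
    using that by (simp add: sum.subset_diff)
  show ?thesis
  proof (rule bij_betw_byWitness[where f' = j])
    have 1: "i t \<in> MT_slice n N \<and> j (i t) = t" if "t \<in> T" for t
    proof -
      obtain A u v where t: "t = (A, u, v)" by (cases t) auto
      with that have A: "A \<subseteq> {1..n}" and u: "u \<in> positive_tuples A N"
        and v: "v \<in> positive_tuples ({1..n} - A) N"
        by (simp_all add: T_def)
      have pos: "u k > 0" if "k \<in> A" for k using u that by (auto simp: positive_tuples_def)
      have neg: "v k > 0" if "k \<in> {1..n} - A" for k using v that by (auto simp: positive_tuples_def)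
      have iA: "i t k = int (u k)" if "k \<in> A" for k using that by (simp add: i_def t)
      have iB: "i t k = - int (v k)" if "k \<in> {1..n} - A" for k using that by (simp add: i_def t)
      have Aeq: "{k \<in> {1..n}. i t k > 0} = A"
      proof (intro set_eqI iffI)
        fix k assume k: "k \<in> {k \<in> {1..n}. i t k > 0}"
        show "k \<in> A"
        proof (rule ccontr)
          assume "k \<notin> A"
          with k have "k \<in> {1..n} - A" by blast
          then show False using k iB[of k] by simp
        qed
      qed (use A pos iA in auto)
      have sA: "(\<Sum>k\<in>A. i t k) = int N"
        using u iA by (simp add: positive_tuples_def flip: of_nat_sum)
      have sB: "(\<Sum>k\<in>{1..n} - A. i t k) = - int N"
        using v iB by (simp add: positive_tuples_def sum_negf flip: of_nat_sum)
      have "i t \<in> {1..n} \<rightarrow>\<^sub>E - {0}"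
        unfolding i_def t using pos neg A by (intro PiE_I) (auto simp: less_imp_neq[symmetric])
      then have "i t \<in> MT_slice n N"
        unfolding MT_slice_def MT_indices_def using Aeq sA sB split[OF A, of "i t"] by simp
      moreover have "restrict (\<lambda>k. nat (i t k)) A = u"
        using u iA by (auto simp: positive_tuples_def PiE_iff extensional_def fun_eq_iff restrict_def)
      moreover have "restrict (\<lambda>k. nat (- i t k)) ({1..n} - A) = v"
        using v iB by (auto simp: positive_tuples_def PiE_iff extensional_def fun_eq_iff restrict_def)
      ultimately show ?thesis
        unfolding j_def Let_def Aeq by (simp add: t)
    qed
    have 2: "j a \<in> T \<and> i (j a) = a" if "a \<in> MT_slice n N" for a
    proof -
      define A where "A = {k \<in> {1..n}. a k > 0}"
      have A: "A \<subseteq> {1..n}" by (auto simp: A_def)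
      have a: "a \<in> {1..n} \<rightarrow>\<^sub>E - {0}" "(\<Sum>k=1..n. a k) = 0" "(\<Sum>k\<in>A. a k) = int N"
        using that by (auto simp: MT_slice_def MT_indices_def A_def)
      have B: "(\<Sum>k\<in>{1..n} - A. - a k) = int N"
        using split[OF A, of a] a by (simp add: sum_negf)
      have neg: "a k < 0" if "k \<in> {1..n} - A" for k
        using that a by (fastforce simp: A_def PiE_iff)
      have "int (\<Sum>k\<in>A. nat (a k)) = (\<Sum>k\<in>A. a k)"
        unfolding of_nat_sum by (intro sum.cong) (auto simp: A_def)
      moreover have "int (\<Sum>k\<in>{1..n} - A. nat (- a k)) = (\<Sum>k\<in>{1..n} - A. - a k)"
        unfolding of_nat_sum using neg by (intro sum.cong) (auto simp: less_imp_le)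
      ultimately have "(\<Sum>k\<in>A. nat (a k)) = N" "(\<Sum>k\<in>{1..n} - A. nat (- a k)) = N"
        unfolding a(3) B by (simp_all only: of_nat_eq_iff)
      moreover have j: "j a = (A, restrict (\<lambda>k. nat (a k)) A, restrict (\<lambda>k. nat (- a k)) ({1..n} - A))"
        unfolding j_def Let_def A_def ..
      ultimately have "j a \<in> T"
        unfolding j T_def positive_tuples_def using A neg by (auto simp: A_def)
      moreover have "i (j a) k = a k" for k
      proof (cases "k \<in> {1..n}")
        case True
        then show ?thesis using neg[of k] by (auto simp: i_def j A_def)
      next
        case False
        then show ?thesis using A a(1) by (auto simp: i_def j PiE_iff extensional_def)
      qed
      ultimately show ?thesis by (simp add: fun_eq_iff)
    qed
    show "\<forall>t\<in>T. j (i t) = t" "\<forall>a\<in>MT_slice n N. i (j a) = a" "i ` T \<subseteq> MT_slice n N" "j ` MT_slice n N \<subseteq> T"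
      using 1 2 by auto
  qed
qed

lemma finite_MT_slice: "finite (MT_slice n N)"
  by (rule bij_betw_finite[THEN iffD1, OF bij_betw_MT_slice])
     (auto intro!: finite_SigmaI finite_positive_tuples intro: finite_subset)

text \<open>For fixed \<open>A\<close> the sum factors into one over the positive and one over the
  negative positions, and each factor depends only on a cardinality.\<close>

lemma sum_MT_slice:
  "(\<Sum>a\<in>MT_slice n N. MT_term n (\<lambda>_. 1) a) =
     fact n * (\<Sum>p\<le>n. real (stirling N p) * real (stirling N (n - p))) / (fact N)\<^sup>2"
proof -
  let ?T = "Sigma (Pow {1..n}) (\<lambda>A. positive_tuples A N \<times> positive_tuples ({1..n} - A) N)"
  let ?S = "\<lambda>p. fact p * real (stirling N p) / fact N"
  let ?P = "\<lambda>A u. \<Prod>k\<in>A. 1 / real (u k)"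
  have "(\<Sum>a\<in>MT_slice n N. MT_term n (\<lambda>_. 1) a) =
    (\<Sum>(A, u, v)\<in>?T. MT_term n (\<lambda>_. 1)
      (\<lambda>k. if k \<in> A then int (u k) else if k \<in> {1..n} then - int (v k) else undefined))"
    by (subst sum.reindex_bij_betw[OF bij_betw_MT_slice, symmetric]) (simp add: case_prod_unfold)
  also have "\<dots> = (\<Sum>(A, u, v)\<in>?T. ?P A u * ?P ({1..n} - A) v)"
  proof (rule sum.cong, rule refl, clarify)
    fix A u v assume A: "A \<subseteq> {1..n}"
    let ?a = "\<lambda>k. if k \<in> A then int (u k) else if k \<in> {1..n} then - int (v k) else undefined"
    have "MT_term n (\<lambda>_. 1) ?a = (\<Prod>k=1..n. 1 / \<bar>real_of_int (?a k)\<bar>)"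
      by (simp add: MT_term_def abs_prod prod_dividef)
    also have "\<dots> = (\<Prod>k\<in>{1..n} - A. 1 / \<bar>real_of_int (?a k)\<bar>) * (\<Prod>k\<in>A. 1 / \<bar>real_of_int (?a k)\<bar>)"
      using A by (simp only: prod.subset_diff finite_atLeastAtMost)
    also have "(\<Prod>k\<in>{1..n} - A. 1 / \<bar>real_of_int (?a k)\<bar>) = ?P ({1..n} - A) v"
      by (intro prod.cong) auto
    also have "(\<Prod>k\<in>A. 1 / \<bar>real_of_int (?a k)\<bar>) = ?P A u"
      by (intro prod.cong) auto
    finally show "MT_term n (\<lambda>_. 1) ?a = ?P A u * ?P ({1..n} - A) v" by simp
  qed
  also have "\<dots> = (\<Sum>A\<in>Pow {1..n}. \<Sum>(u, v)\<in>positive_tuples A N \<times> positive_tuples ({1..n} - A) N.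
      ?P A u * ?P ({1..n} - A) v)"
    by (subst sum.Sigma) (auto intro!: finite_cartesian_product finite_positive_tuples intro: finite_subset)
  also have "\<dots> = (\<Sum>A\<in>Pow {1..n}. ?S (card A) * ?S (n - card A))"
  proof (rule sum.cong)
    fix A assume "A \<in> Pow {1..n}"
    then have "finite A" "card ({1..n} - A) = n - card A"
      by (auto simp: card_Diff_subset finite_subset)
    then show "(\<Sum>(u, v)\<in>positive_tuples A N \<times> positive_tuples ({1..n} - A) N. ?P A u * ?P ({1..n} - A) v)
       = ?S (card A) * ?S (n - card A)"
      using sum_positive_tuples[of A N] sum_positive_tuples[of "{1..n} - A" N]
      by (simp add: sum.cartesian_product[symmetric] sum_product[symmetric])
  qed simp
  \<comment> \<open>Grouping by \<open>p = card A\<close> gives \<open>n choose p\<close> equal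
    terms, and \<open>(n choose p) p! (n - p)! = n!\<close>.\<close>
  also have "\<dots> = (\<Sum>p\<le>n. \<Sum>A\<in>{A \<in> Pow {1..n}. card A = p}. ?S (card A) * ?S (n - card A))"
    using card_mono[of "{1..n}"] by (subst sum.group) auto
  also have "\<dots> = (\<Sum>p\<le>n. real (n choose p) * (?S p * ?S (n - p)))"
    by (intro sum.cong) (simp_all add: n_subsets)
  also have "\<dots> = (\<Sum>p\<le>n. fact n * (real (stirling N p) * real (stirling N (n - p))) / (fact N)\<^sup>2)"
    by (intro sum.cong) (simp_all add: binomial_fact power2_eq_square)
  finally show ?thesis
    by (simp add: sum_distrib_left sum_divide_distrib)
qed

section \<open>The hypergeometric value F(x, x; 1; 1)\<close>

text \<open>The \<open>N\<close>-th term of \<open>F(x, x; m + 1; 1)\<close>. Gauss's theorem follows by letting \<open>m \<rightarrow> \<infinity>\<close> along the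
  contiguous relation, whose defect telescopes in \<open>N\<close>.\<close>

definition hyp_term :: "real \<Rightarrow> nat \<Rightarrow> nat \<Rightarrow> real" where
  "hyp_term x m N = (pochhammer x N)\<^sup>2 * fact m / (fact (m + N) * fact N)"

lemma hyp_term_nonneg: "hyp_term x m N \<ge> 0"
  by (simp add: hyp_term_def)

lemma hyp_term_0: "hyp_term x 0 N = (pochhammer x N / fact N)\<^sup>2"
  by (simp add: hyp_term_def power2_eq_square)

text \<open>Termwise form of \<open>c (c - 2 x) F(x, x; c; 1) = (c - x)^2 F(x, x; c + 1; 1)\<close>
  with \<open>c = m + 1\<close>; the right-hand side is the telescoping defect.\<close>

lemma hyp_term_contiguous:
  "real (Suc m) * (real (Suc m) - 2 * x) * hyp_term x m N - (real (Suc m) - x)\<^sup>2 * hyp_term x (Suc m) N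
   = real (Suc m) * (real N * hyp_term x m N - real (Suc N) * hyp_term x m (Suc N))"
proof -
  define c where "c = real (Suc m)"
  have pos: "c + real N > 0" by (simp add: c_def)
  have eqs: "fact (Suc m + N) = (c + real N) * fact (m + N)" "fact (Suc m) = c * fact m"
    by (simp_all add: c_def algebra_simps)
  have A: "hyp_term x (Suc m) N = hyp_term x m N * (c / (c + real N))"
    unfolding hyp_term_def eqs by (simp add: mult_ac)
  have "fact (m + Suc N) = (c + real N) * fact (m + N)" by (simp add: c_def algebra_simps)
  moreover have "(pochhammer x (Suc N))\<^sup>2 = (pochhammer x N)\<^sup>2 * (x + real N)\<^sup>2"
    by (simp add: pochhammer_Suc power_mult_distrib)
  ultimately have B: "real (Suc N) * hyp_term x m (Suc N) = hyp_term x m N * ((x + real N)\<^sup>2 / (c + real N))"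
    unfolding hyp_term_def using pos by (simp add: divide_simps del: of_nat_Suc)
  \<comment> \<open>All terms are multiples of \<open>hyp_term x m N\<close>; this is the rational
    identity left between the factors.\<close>
  have "c * (c - 2 * x) - (c - x)\<^sup>2 * (c / (c + real N)) = c * (real N - (x + real N)\<^sup>2 / (c + real N))"
    using pos by (simp add: field_simps power2_eq_square)
  then have "hyp_term x m N * (c * (c - 2 * x) - (c - x)\<^sup>2 * (c / (c + real N)))
    = hyp_term x m N * (c * (real N - (x + real N)\<^sup>2 / (c + real N)))"
    by (rule arg_cong)
  then show ?thesis
    unfolding A B c_def[symmetric] by (simp only: algebra_simps)
qed

text \<open>Up to sign \<open>pochhammer x N / fact N\<close> is the binomial coefficient of
  \<open>- x\<close> over \<open>N\<close>, whose known asymptotics bound it by a multiple of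
  \<open>N^(x - 1)\<close>; the term is its square.\<close>

lemma hyp_term_0_bound:
  obtains K where "\<And>N. N \<ge> 1 \<Longrightarrow> hyp_term x 0 N \<le> K * real N powr (2 * x - 2)"
proof -
  define s where "s = (\<lambda>N. pochhammer x N / fact N * exp ((1 - x) * ln (real N)))"
  have "(\<lambda>n. (- x gchoose n) / ((-1)^n / exp ((- x + 1) * ln (real n)))) = s"
    by (simp add: s_def fun_eq_iff gbinomial_pochhammer power2_eq_square flip: power_mult_distrib)
  then have "s \<longlonglongrightarrow> inverse (Gamma x)"
    using gbinomial_asymptotic[of "- x"] by simp
  then have "Bseq s" by (meson convergentI convergent_imp_Bseq)
  then obtain K where K: "\<And>N. \<bar>s N\<bar> \<le> K" by (auto simp: Bseq_def)
  have "hyp_term x 0 N \<le> K\<^sup>2 * real N powr (2 * x - 2)" if N: "N \<ge> 1" for N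
  proof -
    have "pochhammer x N / fact N = s N * real N powr (x - 1)"
      using N by (simp add: s_def powr_def flip: exp_add) (simp add: algebra_simps)
    then have "hyp_term x 0 N = (s N)\<^sup>2 * (real N powr (x - 1))\<^sup>2"
      by (simp add: hyp_term_0 power_mult_distrib)
    also have "(real N powr (x - 1))\<^sup>2 = real N powr (2 * x - 2)"
      by (simp add: power2_eq_square flip: powr_add)
    also have "(s N)\<^sup>2 \<le> K\<^sup>2"
      using K[of N] by (metis abs_ge_zero abs_le_square_iff abs_of_nonneg order_trans)
    finally show ?thesis by (simp add: mult_right_mono)
  qed
  with that show ?thesis by blast
qed

lemma hyp_term_le: "hyp_term x m N \<le> hyp_term x 0 N"
proof -
  have "(fact m * fact N :: nat) \<le> fact (m + N)"
    by (rule dvd_imp_le[OF fact_fact_dvd_fact]) simp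
  then have "(fact m * fact N :: real) \<le> fact (m + N)"
    by (metis of_nat_fact of_nat_le_iff of_nat_mult)
  then have "fact m / fact (m + N) \<le> (1 / fact N :: real)"
    by (simp add: field_simps)
  then have "(pochhammer x N)\<^sup>2 / fact N * (fact m / fact (m + N)) \<le> (pochhammer x N)\<^sup>2 / fact N * (1 / fact N)"
    by (rule mult_left_mono) simp
  then show ?thesis by (simp add: hyp_term_def mult_ac)
qed

text \<open>This says that \<open>m + N choose N\<close> is at least \<open>m + 1\<close>. It
  supplies the decay in \<open>m\<close> of all terms but the one at \<open>N = 0\<close>.\<close>

lemma fact_mult_fact_mult_Suc_le:
  assumes "N \<ge> 1" shows "fact m * fact N * real (Suc m) \<le> fact (m + N)"
  using assms
proof (induction N rule: dec_induct)
  case base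
  then show ?case by simp
next
  case (step N)
  have "fact m * fact (Suc N) * real (Suc m) = real (Suc N) * (fact m * fact N * real (Suc m))"
    by (simp add: algebra_simps)
  also have "\<dots> \<le> real (Suc (m + N)) * fact (m + N)"
    using step.IH by (intro mult_mono) auto
  finally show ?case by simp
qed

lemma hyp_term_le_divide:
  assumes "N \<ge> 1" shows "hyp_term x m N \<le> hyp_term x 0 N / real (Suc m)"
proof -
  have "fact m / fact (m + N) \<le> 1 / (fact N * real (Suc m))"
    using fact_mult_fact_mult_Suc_le[OF assms, of m] by (simp add: field_simps del: of_nat_Suc)
  then have "(pochhammer x N)\<^sup>2 / fact N * (fact m / fact (m + N))
      \<le> (pochhammer x N)\<^sup>2 / fact N * (1 / (fact N * real (Suc m)))"
    by (rule mult_left_mono) simp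
  then show ?thesis by (simp add: hyp_term_def mult_ac)
qed

context
  fixes x :: real
  assumes x: "x < 1 / 2"
begin

text \<open>Comparison with \<open>N^(2 x - 2)\<close>, whose exponent is below \<open>-1\<close>
  exactly when \<open>x < 1 / 2\<close>.\<close>

lemma summable_hyp_term: "summable (hyp_term x m)"
proof -
  obtain K where K: "\<And>N. N \<ge> 1 \<Longrightarrow> hyp_term x 0 N \<le> K * real N powr (2 * x - 2)"
    using hyp_term_0_bound[of x] by blast
  have "summable (\<lambda>N. K * real N powr (2 * x - 2))"
    using x by (intro summable_mult) (simp add: summable_real_powr_iff)
  then show ?thesis
  proof (rule summable_comparison_test'[where N = 1])
    fix N :: nat assume "N \<ge> 1"
    then show "norm (hyp_term x m N) \<le> K * real N powr (2 * x - 2)"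
      using K[of N] hyp_term_le[of x m N] hyp_term_nonneg[of x m N] by simp
  qed
qed

text \<open>This is the boundary term at infinity of the telescoping sum; it is bounded by a
  multiple of \<open>N^(2 x - 1)\<close>.\<close>

lemma tendsto_mult_hyp_term: "(\<lambda>N. real N * hyp_term x m N) \<longlonglongrightarrow> 0"
proof -
  obtain K where K: "\<And>N. N \<ge> 1 \<Longrightarrow> hyp_term x 0 N \<le> K * real N powr (2 * x - 2)"
    using hyp_term_0_bound[of x] by blast
  have "(\<lambda>N. real N powr (2 * x - 1)) \<longlonglongrightarrow> 0"
    using x by (intro tendsto_neg_powr filterlim_real_sequentially) simp
  then have "(\<lambda>N. K * real N powr (2 * x - 1)) \<longlonglongrightarrow> 0"
    by (rule tendsto_mult_right_zero)
  then show ?thesis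
  proof (rule tendsto_sandwich[rotated -1])
    show "\<forall>\<^sub>F N in sequentially. real N * hyp_term x m N \<le> K * real N powr (2 * x - 1)"
      using eventually_ge_at_top[of 1]
    proof eventually_elim
      case (elim N)
      have "real N * hyp_term x m N \<le> real N * (K * real N powr (2 * x - 2))"
        using K[OF elim] hyp_term_le[of x m N] by (intro mult_left_mono) auto
      also have "\<dots> = K * (real N powr 1 * real N powr (2 * x - 2))"
        using elim by simp
      also have "real N powr 1 * real N powr (2 * x - 2) = real N powr (2 * x - 1)"
        by (subst powr_add[symmetric]) (simp add: algebra_simps)
      finally show ?case .
    qed
  qed (auto simp: hyp_term_nonneg)
qed

lemma suminf_hyp_term_contiguous:
  "real (Suc m) * (real (Suc m) - 2 * x) * suminf (\<lambda>N. hyp_term x m N)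
    = (real (Suc m) - x)\<^sup>2 * suminf (\<lambda>N. hyp_term x (Suc m) N)"
proof -
  \<comment> \<open>The telescoping sum is its first term, which has the factor
    \<open>N = 0\<close>, minus the limit \<open>0\<close>.\<close>
  have "(\<lambda>N. real (Suc m) * (real N * hyp_term x m N - real (Suc N) * hyp_term x m (Suc N))) sums
     (real (Suc m) * (real 0 * hyp_term x m 0 - 0))"
    by (intro sums_mult telescope_sums' tendsto_mult_hyp_term)
  then have "(\<lambda>N. real (Suc m) * (real (Suc m) - 2 * x) * hyp_term x m N
      - (real (Suc m) - x)\<^sup>2 * hyp_term x (Suc m) N) sums 0"
    by (simp only: hyp_term_contiguous) simp
  moreover have "(\<lambda>N. real (Suc m) * (real (Suc m) - 2 * x) * hyp_term x m N
      - (real (Suc m) - x)\<^sup>2 * hyp_term x (Suc m) N) sums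
      (real (Suc m) * (real (Suc m) - 2 * x) * suminf (\<lambda>N. hyp_term x m N)
      - (real (Suc m) - x)\<^sup>2 * suminf (\<lambda>N. hyp_term x (Suc m) N))"
    by (intro sums_diff sums_mult summable_sums summable_hyp_term)
  ultimately show ?thesis using sums_unique2 by fastforce
qed

text \<open>Iterating the contiguous relation from \<open>0\<close> to \<open>M\<close> multiplies
  the factors \<open>i (i - 2 x)\<close> and \<open>(i - x)^2\<close> for
  \<open>1 \<le> i \<le> M\<close>.\<close>

lemma suminf_hyp_term_0_eq:
  "fact M * pochhammer (1 - 2 * x) M * suminf (\<lambda>N. hyp_term x 0 N) =
     (pochhammer (1 - x) M)\<^sup>2 * suminf (\<lambda>N. hyp_term x M N)"
proof (induction M)
  case 0
  then show ?case by simp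
next
  case (Suc M)
  have shift: "1 - x + real M = real (Suc M) - x" by simp
  have "fact (Suc M) * pochhammer (1 - 2 * x) (Suc M) * suminf (\<lambda>N. hyp_term x 0 N)
    = real (Suc M) * (real (Suc M) - 2 * x) * (fact M * pochhammer (1 - 2 * x) M * suminf (\<lambda>N. hyp_term x 0 N))"
    by (simp add: pochhammer_Suc algebra_simps)
  also have "\<dots> = (pochhammer (1 - x) M)\<^sup>2 * (real (Suc M) * (real (Suc M) - 2 * x) * suminf (\<lambda>N. hyp_term x M N))"
    unfolding Suc.IH by (simp only: mult_ac)
  also have "\<dots> = (pochhammer (1 - x) (Suc M))\<^sup>2 * suminf (\<lambda>N. hyp_term x (Suc M) N)"
    unfolding suminf_hyp_term_contiguous pochhammer_Suc[of "1 - x"] power_mult_distrib shift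
    by (simp only: mult_ac)
  finally show ?case .
qed

text \<open>The term at \<open>N = 0\<close> is always \<open>1\<close>, and the remaining sum is at
  most a constant divided by \<open>M + 1\<close>.\<close>

lemma tendsto_suminf_hyp_term: "(\<lambda>M. suminf (\<lambda>N. hyp_term x M N)) \<longlonglongrightarrow> 1"
proof -
  let ?S = "suminf (\<lambda>N. hyp_term x 0 (Suc N))"
  have S: "suminf (\<lambda>N. hyp_term x M N) = 1 + suminf (\<lambda>N. hyp_term x M (Suc N))" for M
    using suminf_split_head[OF summable_hyp_term[of M]] by (simp add: hyp_term_def[of _ _ 0])
  have sm: "summable (\<lambda>N. hyp_term x M (Suc N))" for M
    using summable_hyp_term[of M] by (simp add: summable_Suc_iff)
  have "(\<lambda>M. suminf (\<lambda>N. hyp_term x M (Suc N))) \<longlonglongrightarrow> 0"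
  proof (rule tendsto_sandwich)
    show "\<forall>\<^sub>F M in sequentially. 0 \<le> suminf (\<lambda>N. hyp_term x M (Suc N))"
      by (intro always_eventually allI suminf_nonneg sm hyp_term_nonneg)
    show "\<forall>\<^sub>F M in sequentially. suminf (\<lambda>N. hyp_term x M (Suc N)) \<le> ?S * inverse (real (Suc M))"
    proof (intro always_eventually allI)
      fix M
      have "suminf (\<lambda>N. hyp_term x M (Suc N)) \<le> suminf (\<lambda>N. hyp_term x 0 (Suc N) / real (Suc M))"
        by (intro suminf_le sm summable_divide hyp_term_le_divide) simp
      then show "suminf (\<lambda>N. hyp_term x M (Suc N)) \<le> ?S * inverse (real (Suc M))"
        by (simp only: divide_inverse suminf_mult2[OF sm])
    qed
    show "(\<lambda>M. ?S * inverse (real (Suc M))) \<longlonglongrightarrow> 0"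
      by (intro tendsto_mult_right_zero LIMSEQ_inverse_real_of_nat)
  qed simp
  then have "(\<lambda>M. 1 + suminf (\<lambda>N. hyp_term x M (Suc N))) \<longlonglongrightarrow> 1 + 0"
    by (intro tendsto_intros)
  then show ?thesis by (simp flip: S)
qed

text \<open>Gauss's theorem for \<open>F(x, x; 1; 1)\<close>: the Pochhammer quotient from the
  iterated relation is a quotient of approximants of Gamma.\<close>

lemma sums_pochhammer_squared:
  "(\<lambda>N. (pochhammer x N / fact N)\<^sup>2) sums (Gamma (1 - 2 * x) / (Gamma (1 - x))\<^sup>2)"
proof -
  let ?S = "suminf (\<lambda>N. hyp_term x 0 N)"
  let ?G = "Gamma_series' :: real \<Rightarrow> nat \<Rightarrow> real"
  have pos: "pochhammer (1 - 2 * x) M > 0" "pochhammer (1 - x) M > 0" for M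
    using x by (auto intro!: pochhammer_pos)
  have "(\<lambda>M. ?G (1 - 2 * x) M * ?G 1 M / (?G (1 - x) M)\<^sup>2 * suminf (\<lambda>N. hyp_term x M N))
      \<longlonglongrightarrow> Gamma (1 - 2 * x) * Gamma 1 / (Gamma (1 - x))\<^sup>2 * 1"
    using x Gamma_real_pos[of "1 - x", THEN less_imp_neq]
    by (intro tendsto_intros Gamma_series'_LIMSEQ tendsto_suminf_hyp_term) auto
  \<comment> \<open>The convergent sequence is eventually the constant \<open>?S\<close>, so
    \<open>?S\<close> is its limit.\<close>
  moreover have "\<forall>\<^sub>F M in sequentially.
      ?G (1 - 2 * x) M * ?G 1 M / (?G (1 - x) M)\<^sup>2 * suminf (\<lambda>N. hyp_term x M N) = ?S"
    using eventually_gt_at_top[of 0]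
  proof eventually_elim
    case (elim M)
    let ?e = "\<lambda>z::real. exp (z * ln (real M))"
    \<comment> \<open>The powers of \<open>M\<close> cancel because
      \<open>(1 - 2 x) + 1 = 2 (1 - x)\<close>.\<close>
    have e: "?e (1 - 2 * x) * ?e 1 = (?e (1 - x))\<^sup>2"
      by (simp add: power2_eq_square algebra_simps flip: exp_add)
    have "?G (1 - 2 * x) M * ?G 1 M / (?G (1 - x) M)\<^sup>2 =
       (fact (M - 1))\<^sup>2 * (?e (1 - 2 * x) * ?e 1) / (pochhammer (1 - 2 * x) M * fact M)
        / ((fact (M - 1))\<^sup>2 * (?e (1 - x))\<^sup>2 / (pochhammer (1 - x) M)\<^sup>2)"
      by (simp add: Gamma_series'_def power2_eq_square mult_ac flip: pochhammer_fact)
    also have "\<dots> = (pochhammer (1 - x) M)\<^sup>2 / (pochhammer (1 - 2 * x) M * fact M)"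
      unfolding e by simp
    finally have ratio: "?G (1 - 2 * x) M * ?G 1 M / (?G (1 - x) M)\<^sup>2 =
      (pochhammer (1 - x) M)\<^sup>2 / (pochhammer (1 - 2 * x) M * fact M)" .
    show ?case
      unfolding ratio using suminf_hyp_term_0_eq[of M] pos(1)[of M] by (simp add: field_simps)
  qed
  ultimately have "(\<lambda>M::nat. ?S) \<longlonglongrightarrow> Gamma (1 - 2 * x) * Gamma 1 / (Gamma (1 - x))\<^sup>2 * 1"
    by (rule Lim_transform_eventually)
  then have "?S = Gamma (1 - 2 * x) / (Gamma (1 - x))\<^sup>2"
    by (simp add: LIMSEQ_const_iff)
  then have "hyp_term x 0 sums (Gamma (1 - 2 * x) / (Gamma (1 - x))\<^sup>2)"
    using summable_sums[OF summable_hyp_term[of 0]] by simp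
  then show ?thesis by (simp only: hyp_term_0[abs_def])
qed

end

section \<open>The generating function\<close>

text \<open>The slice sum divided by \<open>n!\<close>, and also the coefficient of
  \<open>x^n\<close> in the square of \<open>pochhammer x N / fact N\<close>.\<close>

definition MT_slice_coeff :: "nat \<Rightarrow> nat \<Rightarrow> real" where
  "MT_slice_coeff N n = (\<Sum>p\<le>n. real (stirling N p) * real (stirling N (n - p))) / (fact N)\<^sup>2"

lemma MT_slice_coeff_nonneg: "MT_slice_coeff N n \<ge> 0"
  by (simp add: MT_slice_coeff_def sum_nonneg)

lemma has_sum_MT_slice_coeff:
  "((\<lambda>n. MT_slice_coeff N n * x ^ n) has_sum (pochhammer x N / fact N)\<^sup>2) UNIV"
proof -
  have "(pochhammer x N)\<^sup>2 = (\<Sum>r\<le>N + N. (\<Sum>k\<le>r. real (stirling N k) * real (stirling N (r - k))) * x ^ r)"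
    unfolding power2_eq_square stirling_pochhammer[symmetric]
    by (rule polynomial_product) simp_all
  then have "(pochhammer x N / fact N)\<^sup>2 = (\<Sum>n\<le>N + N. MT_slice_coeff N n * x ^ n)"
    unfolding MT_slice_coeff_def power_divide by (simp only: times_divide_eq_left flip: sum_divide_distrib)
  \<comment> \<open>For \<open>n > 2 N\<close> one of \<open>p\<close> and \<open>n - p\<close>
    exceeds \<open>N\<close>, so a Stirling number vanishes and the sum over \<open>n\<close> is
    finite.\<close>
  moreover have "MT_slice_coeff N n = 0" if "n > N + N" for n
  proof -
    have "real (stirling N p) * real (stirling N (n - p)) = 0" for p
      using that by (cases "p \<le> N") simp_all
    then show ?thesis unfolding MT_slice_coeff_def by (simp only: sum.neutral_const div_0)
  qed
  ultimately show ?thesis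
    by (intro has_sum_finite_neutralI[of "{..N + N}"]) simp_all
qed

context
  fixes x :: real
  assumes x: "\<bar>x\<bar> < 1 / 2"
begin

text \<open>The coefficients are nonnegative, so the absolute values form the family at
  \<open>\<bar>x\<bar>\<close>, which Gauss's theorem sums as well.\<close>

lemma summable_MT_slice_coeff_prod:
  "(\<lambda>(N, n). MT_slice_coeff N n * x ^ n) summable_on (UNIV \<times> UNIV)"
proof -
  have "summable (\<lambda>N. (pochhammer \<bar>x\<bar> N / fact N)\<^sup>2)"
    using x by (intro sums_summable[OF sums_pochhammer_squared])
  then have "(\<lambda>N. (pochhammer \<bar>x\<bar> N / fact N)\<^sup>2) summable_on UNIV"
    by (rule summable_nonneg_imp_summable_on) (rule zero_le_power2)
  then have "(\<lambda>(N, n). MT_slice_coeff N n * \<bar>x\<bar> ^ n) summable_on (UNIV \<times> UNIV)"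
  proof (rule summable_on_SigmaI[rotated])
    show "((\<lambda>n. case (N, n) of (N, n) \<Rightarrow> MT_slice_coeff N n * \<bar>x\<bar> ^ n) has_sum
        (pochhammer \<bar>x\<bar> N / fact N)\<^sup>2) UNIV" for N
      unfolding prod.case by (rule has_sum_MT_slice_coeff)
  qed (simp add: MT_slice_coeff_nonneg)
  moreover have "(\<lambda>t. norm (case t of (N, n) \<Rightarrow> MT_slice_coeff N n * x ^ n)) =
      (\<lambda>(N, n). MT_slice_coeff N n * \<bar>x\<bar> ^ n)"
    by (auto simp: fun_eq_iff abs_mult power_abs MT_slice_coeff_nonneg)
  ultimately show ?thesis
    by (simp only: Infinite_Sum.abs_summable_summable)
qed

lemma has_sum_MT_slice_coeff_prod:
  "((\<lambda>(N, n). MT_slice_coeff N n * x ^ n) has_sum (Gamma (1 - 2 * x) / (Gamma (1 - x))\<^sup>2)) (UNIV \<times> UNIV)"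
proof (rule has_sum_SigmaI)
  show "((\<lambda>N. (pochhammer x N / fact N)\<^sup>2) has_sum (Gamma (1 - 2 * x) / (Gamma (1 - x))\<^sup>2)) UNIV"
    using x by (intro sums_nonneg_imp_has_sum sums_pochhammer_squared) simp_all
  show "(\<lambda>(N, n). MT_slice_coeff N n * x ^ n) summable_on UNIV \<times> UNIV"
    by (rule summable_MT_slice_coeff_prod)
  show "((\<lambda>n. case (N, n) of (N, n) \<Rightarrow> MT_slice_coeff N n * x ^ n) has_sum (pochhammer x N / fact N)\<^sup>2) UNIV" for N
    unfolding prod.case by (rule has_sum_MT_slice_coeff)
qed

end

lemma summable_MT_slice_coeff: "(\<lambda>N. MT_slice_coeff N n) summable_on UNIV"
proof -
  \<comment> \<open>The point \<open>1/4\<close> is an arbitrary one in \<open>(0, 1/2)\<close>; its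
    power is constant for fixed \<open>n\<close> and is divided out.\<close>
  have "(\<lambda>(N, n). MT_slice_coeff N n * (1/4) ^ n) summable_on (UNIV \<times> UNIV)"
    by (rule summable_MT_slice_coeff_prod) simp
  then have "(\<lambda>(n, N). MT_slice_coeff N n * (1/4) ^ n) summable_on (UNIV \<times> UNIV)"
    by (subst (asm) summable_on_swap) simp
  then have "(\<lambda>N. MT_slice_coeff N n * (1/4) ^ n) summable_on UNIV"
    by (rule summable_on_SigmaD1) simp
  then have "(\<lambda>N. MT_slice_coeff N n * (1/4) ^ n * 4 ^ n) summable_on UNIV"
    by (rule summable_on_cmult_left)
  then show ?thesis by (simp add: mult.assoc flip: power_mult_distrib)
qed

definition MT_fps :: "real fps" where
  "MT_fps = Abs_fps (\<lambda>n. \<Sum>\<^sub>\<infinity>N. MT_slice_coeff N n)"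

text \<open>Absolute convergence of the double family permits summing over \<open>N\<close> first
  instead of over \<open>n\<close>.\<close>

lemma sums_MT_fps:
  assumes "\<bar>x\<bar> < 1 / 2"
  shows "(\<lambda>n. fps_nth MT_fps n * x ^ n) sums (Gamma (1 - 2 * x) / (Gamma (1 - x))\<^sup>2)"
proof -
  have "((\<lambda>(n, N). MT_slice_coeff N n * x ^ n) has_sum (Gamma (1 - 2 * x) / (Gamma (1 - x))\<^sup>2)) (UNIV \<times> UNIV)"
    using has_sum_MT_slice_coeff_prod[OF assms] by (subst (asm) has_sum_swap) simp
  then have "((\<lambda>n. fps_nth MT_fps n * x ^ n) has_sum (Gamma (1 - 2 * x) / (Gamma (1 - x))\<^sup>2)) UNIV"
  proof (rule has_sum_SigmaD)
    fix n
    have "((\<lambda>N. MT_slice_coeff N n * x ^ n) has_sum (\<Sum>\<^sub>\<infinity>N. MT_slice_coeff N n) * x ^ n) UNIV"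
      by (intro has_sum_cmult_left has_sum_infsum summable_MT_slice_coeff)
    then show "((\<lambda>N. case (n, N) of (n, N) \<Rightarrow> MT_slice_coeff N n * x ^ n) has_sum fps_nth MT_fps n * x ^ n) UNIV"
      by (simp add: MT_fps_def)
  qed
  then show ?thesis by (rule has_sum_imp_sums)
qed

text \<open>The terms are nonnegative and the slices partition the index set, so summability over
  \<open>N\<close> of the slice sums gives both convergence and value.\<close>

lemma has_sum_MT_term:
  "(MT_term n (\<lambda>_. 1) has_sum fact n * fps_nth MT_fps n) (MT_indices n)"
proof -
  let ?f = "MT_term n (\<lambda>_. 1)" and ?T = "Sigma UNIV (MT_slice n)"
  have nonneg: "?f a \<ge> 0" for a by (simp add: MT_term_def)
  have slice: "(\<Sum>a\<in>MT_slice n N. ?f a) = fact n * MT_slice_coeff N n" for N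
    unfolding sum_MT_slice MT_slice_coeff_def by simp
  have fin: "((\<lambda>a. ?f (snd (N, a))) has_sum fact n * MT_slice_coeff N n) (MT_slice n N)" for N
    using has_sum_finite[OF finite_MT_slice, of ?f n N] unfolding slice snd_conv .
  have sm: "(\<lambda>N. fact n * MT_slice_coeff N n) summable_on UNIV"
    by (intro summable_on_cmult_right summable_MT_slice_coeff)
  have "(\<lambda>t. ?f (snd t)) summable_on ?T"
    by (rule summable_on_SigmaI[OF fin sm]) (rule nonneg)
  moreover have "((\<lambda>N. fact n * MT_slice_coeff N n) has_sum fact n * fps_nth MT_fps n) UNIV"
    unfolding MT_fps_def fps_nth_Abs_fps
    by (intro has_sum_cmult_right has_sum_infsum summable_MT_slice_coeff)
  ultimately have "((\<lambda>t. ?f (snd t)) has_sum fact n * fps_nth MT_fps n) ?T"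
    using fin by (intro has_sum_SigmaI)
  moreover have "bij_betw snd ?T (MT_indices n)"
  proof (intro bij_betwI')
    fix s t assume "s \<in> ?T" "t \<in> ?T"
    then show "snd s = snd t \<longleftrightarrow> s = t"
      by (auto simp: MT_slice_def prod_eq_iff)
  next
    fix a assume a: "a \<in> MT_indices n"
    have "(\<Sum>k | k \<in> {1..n} \<and> a k > 0. a k) \<ge> 0" by (intro sum_nonneg) auto
    then obtain N where "(\<Sum>k | k \<in> {1..n} \<and> a k > 0. a k) = int N"
      using nonneg_int_cases by blast
    with a have "(N, a) \<in> ?T" by (simp add: MT_slice_def)
    then show "\<exists>t\<in>?T. a = snd t" by force
  qed (auto simp: MT_slice_def)
  ultimately show ?thesis
    by (simp add: has_sum_reindex_bij_betw)
qed

lemma has_fps_expansion_MT_fps: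
  "(\<lambda>x. Gamma (1 - 2 * x) / (Gamma (1 - x))\<^sup>2) has_fps_expansion MT_fps"
  unfolding has_fps_expansion_def
proof
  \<comment> \<open>Convergence at the single point \<open>1/4\<close> already gives a positive
    radius.\<close>
  have "ereal (norm (1 / 4 :: real)) \<le> fps_conv_radius MT_fps"
    unfolding fps_conv_radius_def
    by (rule conv_radius_geI) (use sums_MT_fps[of "1/4"] in \<open>simp add: sums_iff\<close>)
  then show "0 < fps_conv_radius MT_fps"
    by (rule less_le_trans[rotated]) simp
  have "\<forall>\<^sub>F x :: real in nhds 0. x \<in> {- 1 / 2<..<1 / 2}"
    by (rule eventually_nhds_in_open) auto
  then show "\<forall>\<^sub>F x in nhds 0. eval_fps MT_fps x = Gamma (1 - 2 * x) / (Gamma (1 - x))\<^sup>2"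
  proof eventually_elim
    case (elim x)
    then have "\<bar>x\<bar> < 1 / 2" by auto
    then show ?case unfolding eval_fps_def by (rule sums_unique[symmetric, OF sums_MT_fps])
  qed
qed

section \<open>Derivatives of the log-Gamma quotient\<close>

lemma fps_nth_has_fps_expansion:
  fixes f :: "'a :: {banach, real_normed_field} \<Rightarrow> 'a"
  assumes "f has_fps_expansion F"
  shows "fps_nth F n = (deriv ^^ n) f 0 / fact n"
  using assms
proof (induction n arbitrary: f F)
  case 0
  then have "eval_fps F 0 = f 0"
    unfolding has_fps_expansion_def by (meson eventually_nhds_x_imp_x)
  then show ?case by (simp add: eval_fps_at_0)
next
  case (Suc n)
  from Suc.IH[OF has_fps_expansion_deriv[OF Suc.prems]]
  have "of_nat (Suc n) * fps_nth F (Suc n) = (deriv ^^ Suc n) f 0 / fact n"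
    by (simp add: funpow_Suc_right del: funpow.simps of_nat_Suc)
  then show ?case by (simp add: field_simps del: funpow.simps of_nat_Suc)
qed

lemma Gamma_binomial_eq: "Gamma_binomial (- 2 * x) (- x) = Gamma (1 - 2 * x) / (Gamma (1 - x))\<^sup>2"
proof -
  have "- 2 * x + 1 = 1 - 2 * x" "- x + 1 = 1 - x" "- 2 * x - - x + 1 = 1 - x" by simp_all
  then show ?thesis by (simp only: Gamma_binomial_def power2_eq_square)
qed

text \<open>For \<open>x < 1 / 2\<close> both Gamma arguments are positive, so the logarithm of the
  quotient splits.\<close>

lemma ln_Gamma_binomial_eq:
  assumes "x < 1 / 2"
  shows "ln (Gamma_binomial (- 2 * x) (- x)) = ln_Gamma (1 - 2 * x) - 2 * ln_Gamma (1 - x)"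
proof -
  have pos: "1 - 2 * x > 0" "1 - x > 0" using assms by simp_all
  note G = Gamma_real_pos[OF pos(1)] Gamma_real_pos[OF pos(2)]
  have "ln (Gamma (1 - 2 * x) / (Gamma (1 - x))\<^sup>2) = ln (Gamma (1 - 2 * x)) - 2 * ln (Gamma (1 - x))"
    using G by (simp add: ln_div ln_realpow)
  then show ?thesis
    unfolding Gamma_binomial_eq ln_Gamma_real_pos[OF pos(1)] ln_Gamma_real_pos[OF pos(2)] .
qed

lemma not_nonpos_Ints_pos: "x > 0 \<Longrightarrow> x \<notin> \<int>\<^sub>\<le>\<^sub>0" for x :: real
  by (auto elim!: nonpos_Ints_cases)

lemma has_field_derivative_ln_Gamma_binomial:
  assumes "x < 1 / 2"
  shows "((\<lambda>x. ln (Gamma_binomial (- 2 * x) (- x))) has_field_derivative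
     2 * Digamma (1 - x) - 2 * Digamma (1 - 2 * x)) (at x)"
proof -
  have "((\<lambda>x. ln_Gamma (1 - 2 * x) - 2 * ln_Gamma (1 - x)) has_field_derivative
     2 * Digamma (1 - x) - 2 * Digamma (1 - 2 * x)) (at x)"
    using assms by (auto intro!: derivative_eq_intros)
  moreover have "\<forall>\<^sub>F y in nhds x. y \<in> {..<1 / 2}"
    using assms by (intro eventually_nhds_in_open) auto
  then have ev: "\<forall>\<^sub>F y in nhds x. ln (Gamma_binomial (- 2 * y) (- y)) = ln_Gamma (1 - 2 * y) - 2 * ln_Gamma (1 - y)"
    by eventually_elim (rule ln_Gamma_binomial_eq, simp)
  ultimately show ?thesis
    by (simp only: DERIV_cong_ev[OF refl ev refl])
qed

text \<open>Each differentiation raises the Polygamma order and adds a factor \<open>-2\<close> or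
  \<open>-1\<close>. The formula is proved on the whole half-line so that the induction hypothesis
  holds near \<open>x\<close>.\<close>

lemma higher_deriv_ln_Gamma_binomial:
  assumes "x < 1 / 2"
  shows "(deriv ^^ Suc k) (\<lambda>x. ln (Gamma_binomial (- 2 * x) (- x))) x
    = (- 2) ^ Suc k * Polygamma k (1 - 2 * x) - 2 * (- 1) ^ Suc k * Polygamma k (1 - x)"
  using assms
proof (induction k arbitrary: x)
  case 0
  then show ?case
    using DERIV_imp_deriv[OF has_field_derivative_ln_Gamma_binomial[of x]] by simp
next
  case (Suc k)
  let ?f = "\<lambda>x. ln (Gamma_binomial (- 2 * x) (- x))"
  let ?g = "\<lambda>k x. (- 2) ^ Suc k * Polygamma k (1 - 2 * x) - 2 * (- 1) ^ Suc k * Polygamma k (1 - x) :: real"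
  have "\<forall>\<^sub>F y in nhds x. y \<in> {..<1 / 2}"
    using Suc.prems by (intro eventually_nhds_in_open) auto
  then have ev: "\<forall>\<^sub>F y in nhds x. (deriv ^^ Suc k) ?f y = ?g k y"
    by eventually_elim (rule Suc.IH, simp)
  have "(deriv ^^ Suc (Suc k)) ?f x = deriv ((deriv ^^ Suc k) ?f) x" by simp
  also have "\<dots> = deriv (?g k) x"
    by (rule deriv_cong_ev[OF ev refl])
  also have "\<dots> = ?g (Suc k) x"
  proof (rule DERIV_imp_deriv)
    have 1: "1 - 2 * x \<notin> \<int>\<^sub>\<le>\<^sub>0" "1 - x \<notin> \<int>\<^sub>\<le>\<^sub>0"
      using Suc.prems by (intro not_nonpos_Ints_pos; simp)+
    have "((\<lambda>y. Polygamma k (1 - 2 * y)) has_field_derivative Polygamma (Suc k) (1 - 2 * x) * (- 2)) (at x)"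
      by (rule DERIV_chain2[where g = "\<lambda>y. 1 - 2 * y", OF has_field_derivative_Polygamma[OF 1(1)]]) (auto intro!: derivative_eq_intros)
    moreover have "((\<lambda>y. Polygamma k (1 - y)) has_field_derivative Polygamma (Suc k) (1 - x) * (- 1)) (at x)"
      by (rule DERIV_chain2[where g = "\<lambda>y. 1 - y", OF has_field_derivative_Polygamma[OF 1(2)]]) (auto intro!: derivative_eq_intros)
    ultimately have "(?g k has_field_derivative
       (- 2) ^ Suc k * (Polygamma (Suc k) (1 - 2 * x) * (- 2))
        - 2 * (- 1) ^ Suc k * (Polygamma (Suc k) (1 - x) * (- 1))) (at x)"
      by (intro DERIV_diff DERIV_cmult)
    then show "(?g k has_field_derivative ?g (Suc k) x) (at x)"
      by (simp add: mult_ac)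
  qed
  finally show ?case .
qed

section \<open>Zeta and eta values at integers\<close>

lemma zeta_sums:
  assumes "k \<ge> 2"
  shows "(\<lambda>j. 1 / real (Suc j) ^ k) sums zeta (real k)"
proof -
  have "summable (\<lambda>j. inverse ((1 + real j) ^ k))"
    using assms by (intro Polygamma_converges') simp_all
  then have "summable (\<lambda>j. 1 / real (Suc j) ^ k)"
    by (simp add: inverse_eq_divide)
  then have "(\<lambda>j. 1 / real (Suc j) ^ k) sums suminf (\<lambda>j. 1 / real (Suc j) ^ k)"
    by (rule summable_sums)
  then show ?thesis
    unfolding zeta_def by (simp add: powr_realpow del: of_nat_Suc)
qed

lemma Polygamma_1:
  assumes "k \<ge> 1"
  shows "Polygamma k 1 = (- 1) ^ Suc k * fact k * zeta (real (Suc k))"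
proof -
  have "suminf (\<lambda>j. inverse ((1 + real j) ^ Suc k)) = zeta (real (Suc k))"
    using zeta_sums[of "Suc k"] assms by (simp add: sums_iff inverse_eq_divide del: power_Suc)
  then show ?thesis using assms by (simp add: Polygamma_def)
qed

lemma higher_deriv_ln_Gamma_binomial_0:
  assumes "k \<ge> 1"
  shows "(deriv ^^ k) (\<lambda>x. ln (Gamma_binomial (- 2 * x) (- x))) 0
    = (if k = 1 then 0 else (2 ^ k - 2) * Gamma (real k) * zeta (real k))"
proof -
  obtain l where k: "k = Suc l" using assms by (cases k) auto
  have "(deriv ^^ k) (\<lambda>x. ln (Gamma_binomial (- 2 * x) (- x))) 0
    = (- 2) ^ k * Polygamma l 1 - 2 * (- 1) ^ k * Polygamma l 1"
    unfolding k by (subst higher_deriv_ln_Gamma_binomial) simp_all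
  also have "(- 2 :: real) ^ k = (- 1) ^ k * 2 ^ k"
    by (simp flip: power_mult_distrib)
  finally have eq: "(deriv ^^ k) (\<lambda>x. ln (Gamma_binomial (- 2 * x) (- x))) 0
    = (2 ^ k - 2) * ((- 1) ^ k * Polygamma l 1)"
    by (simp add: algebra_simps)
  show ?thesis
  proof (cases "k = 1")
    case True
    \<comment> \<open>The factor \<open>2^1 - 2 = 0\<close> removes the value
      \<open>Polygamma 0 1\<close>, which is not a zeta value.\<close>
    then show ?thesis unfolding eq by simp
  next
    case False
    then have "l \<ge> 1" using k by simp
    have "(- 1) ^ k * Polygamma l 1 = ((- 1) ^ k * (- 1) ^ k) * fact l * zeta (real k)"
      unfolding Polygamma_1[OF \<open>l \<ge> 1\<close>] k by (simp only: mult_ac)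
    also have "(- 1) ^ k * (- 1) ^ k = (1 :: real)"
      by (simp flip: power_mult_distrib)
    also have "1 * fact l = Gamma (real k)"
      using Gamma_fact[of l, where 'a = real] k by simp
    finally show ?thesis using False unfolding eq by simp
  qed
qed

text \<open>The alternating series is the full series minus twice its terms with even denominator,
  and those terms sum to \<open>2^(-k)\<close> times zeta.\<close>

lemma dirichlet_eta_eq:
  assumes "k \<ge> 2"
  shows "2 ^ k * dirichlet_eta (real k) = (2 ^ k - 2) * zeta (real k)"
proof -
  \<comment> \<open>The denominator is \<open>j + 1\<close>, so odd \<open>j\<close> are the even
    denominators.\<close>
  let ?h = "\<lambda>j. if odd j then 2 / real (Suc j) ^ k else 0"
  have "(\<lambda>i. 2 / 2 ^ k * (1 / real (Suc i) ^ k)) sums (2 / 2 ^ k * zeta (real k))"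
    by (intro sums_mult zeta_sums assms)
  moreover have "2 / 2 ^ k * (1 / real (Suc i) ^ k) = ?h (2 * i + 1)" for i
  proof -
    have "real (Suc (2 * i + 1)) = 2 * real (Suc i)" by simp
    then have "real (Suc (2 * i + 1)) ^ k = 2 ^ k * real (Suc i) ^ k"
      by (simp only: power_mult_distrib)
    then show ?thesis by (simp del: of_nat_Suc)
  qed
  ultimately have "(\<lambda>i. ?h (2 * i + 1)) sums (2 / 2 ^ k * zeta (real k))"
    by (simp only:)
  then have h: "?h sums (2 / 2 ^ k * zeta (real k))"
  proof (rule sums_mono_reindex[THEN iffD1, rotated 2])
    show "?h j = 0" if "j \<notin> range (\<lambda>i. 2 * i + 1)" for j
      using that by (metis oddE rangeI)
  qed (simp add: strict_mono_def)
  have "(\<lambda>j. 1 / real (Suc j) ^ k - ?h j) sums (zeta (real k) - 2 / 2 ^ k * zeta (real k))"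
    by (intro sums_diff zeta_sums assms h)
  moreover have "1 / real (Suc j) ^ k - ?h j = (- 1) ^ j / real (Suc j) powr real k" for j
    by (simp add: powr_realpow field_simps del: of_nat_Suc)
  ultimately have "dirichlet_eta (real k) = zeta (real k) - 2 / 2 ^ k * zeta (real k)"
    unfolding dirichlet_eta_def by (simp only: sums_iff)
  then show ?thesis by (simp add: field_simps)
qed

text \<open>By \<open>G = exp f\<close> the logarithmic derivative of the generating function is
  \<open>f'\<close>, so the Taylor coefficients of \<open>f'\<close> are those of
  \<open>D\<close>.\<close>

lemma complete_bell_higher_deriv_eq:
  "complete_bell n (\<lambda>k. (deriv ^^ k) (\<lambda>x. ln (Gamma_binomial (- 2 * x) (- x))) 0) = fact n * fps_nth MT_fps n"
proof -
  let ?f = "\<lambda>x. ln (Gamma_binomial (- 2 * x) (- x))"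
  let ?G = "\<lambda>x. Gamma (1 - 2 * x) / (Gamma (1 - x))\<^sup>2 :: real"
  \<comment> \<open>The inverse is a true one because the constant coefficient is \<open>1\<close>,
    as shown next.\<close>
  define D where "D = fps_deriv MT_fps * inverse MT_fps"
  have G0: "fps_nth MT_fps 0 = 1"
    using fps_nth_has_fps_expansion[OF has_fps_expansion_MT_fps, of 0] by simp
  have exp: "exp (?f x) = ?G x" if "x < 1 / 2" for x
    using that Gamma_real_pos[of "1 - 2 * x"] Gamma_real_pos[of "1 - x"]
    unfolding Gamma_binomial_eq by (intro exp_ln divide_pos_pos zero_less_power) auto
  have "\<forall>\<^sub>F x :: real in nhds 0. x \<in> {..<1 / 2}"
    by (rule eventually_nhds_in_open) auto
  then have ev: "\<forall>\<^sub>F x in nhds 0. deriv ?G x * inverse (?G x) = deriv ?f x"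
  proof eventually_elim
    case (elim x)
    have "\<forall>\<^sub>F y in nhds x. y \<in> {..<1 / 2}"
      using elim by (intro eventually_nhds_in_open) auto
    then have "\<forall>\<^sub>F y in nhds x. ?G y = exp (?f y)"
      by eventually_elim (rule exp[symmetric], simp)
    then have "deriv ?G x = deriv (\<lambda>y. exp (?f y)) x"
      by (rule deriv_cong_ev) simp
    also have "\<dots> = exp (?f x) * deriv ?f x"
      using elim has_field_derivative_ln_Gamma_binomial[of x]
      by (intro DERIV_imp_deriv DERIV_fun_exp) (auto simp: DERIV_imp_deriv)
    finally show ?case
      using exp[of x] elim exp_not_eq_zero[of "?f x"] by simp
  qed
  have "(\<lambda>x. deriv ?G x * inverse (?G x)) has_fps_expansion D"
    unfolding D_def using G0
    by (intro has_fps_expansion_mult has_fps_expansion_deriv has_fps_expansion_inverse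
        has_fps_expansion_MT_fps) simp
  then have "deriv ?f has_fps_expansion D"
    unfolding has_fps_expansion_def using ev by (auto elim: eventually_elim2)
  then have "fps_nth D k = (deriv ^^ Suc k) ?f 0 / fact k" for k
    by (subst fps_nth_has_fps_expansion) (simp_all add: funpow_Suc_right del: funpow.simps)
  moreover have "fps_deriv MT_fps = D * MT_fps"
    unfolding D_def using G0 by (simp add: mult.assoc inverse_mult_eq_1)
  ultimately show ?thesis
    using G0 by (intro complete_bell_eqI)
qed

theorem theorem2p2:
  fixes n :: nat and f :: "real \<Rightarrow> real"
  assumes "n \<ge> 1"
    and f_def: "f = (\<lambda>x. ln (Gamma_binomial (- 2 * x) (- x)))"
  shows "MT_term n (\<lambda>_. 1) summable_on MT_indices n
    \<and> sym_MT_zeta n (\<lambda>_. 1) = complete_bell n (\<lambda>k. (deriv ^^ k) f 0)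
    \<and> sym_MT_zeta n (\<lambda>_. 1) = complete_bell n
          (\<lambda>k. if k = 1 then 0 else (2 ^ k - 2) * Gamma (real k) * zeta (real k))
    \<and> (\<forall>m \<in> Poly_Mapping.keys (zeta_bell_poly n).
          Poly_Mapping.lookup (zeta_bell_poly n) m \<in> \<int>
          \<and> Poly_Mapping.lookup (zeta_bell_poly n) m > 0
          \<and> Poly_Mapping.keys m \<subseteq> {2..n})
    \<and> sym_MT_zeta n (\<lambda>_. 1) = mpoly_eval (\<lambda>k. zeta (real k)) (zeta_bell_poly n)
    \<and> sym_MT_zeta n (\<lambda>_. 1) = complete_bell n
          (\<lambda>k. if k = 1 then 0 else 2 ^ k * Gamma (real k) * dirichlet_eta (real k))"
proof (intro conjI ballI)
  show "MT_term n (\<lambda>_. 1) summable_on MT_indices n"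
    using has_sum_MT_term by (rule has_sum_imp_summable)
  have "sym_MT_zeta n (\<lambda>_. 1) = fact n * fps_nth MT_fps n"
    unfolding sym_MT_zeta_def using has_sum_MT_term by (rule infsumI)
  then show deriv: "sym_MT_zeta n (\<lambda>_. 1) = complete_bell n (\<lambda>k. (deriv ^^ k) f 0)"
    unfolding f_def complete_bell_higher_deriv_eq .
  also have "\<dots> = complete_bell n
      (\<lambda>k. if k = 1 then 0 else (2 ^ k - 2) * Gamma (real k) * zeta (real k))"
    \<comment> \<open>The derivative formula covers \<open>k \<ge> 1\<close>, which suffices since
      the value at \<open>0\<close> is ignored.\<close>
    unfolding f_def by (rule complete_bell_cong) (rule higher_deriv_ln_Gamma_binomial_0)
  finally show zeta: "sym_MT_zeta n (\<lambda>_. 1) = complete_bell n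
      (\<lambda>k. if k = 1 then 0 else (2 ^ k - 2) * Gamma (real k) * zeta (real k))" .
  then show "sym_MT_zeta n (\<lambda>_. 1) = mpoly_eval (\<lambda>k. zeta (real k)) (zeta_bell_poly n)"
    unfolding mpoly_eval_zeta_bell_poly .
  show "sym_MT_zeta n (\<lambda>_. 1) = complete_bell n
      (\<lambda>k. if k = 1 then 0 else 2 ^ k * Gamma (real k) * dirichlet_eta (real k))"
    unfolding zeta
  proof (rule complete_bell_cong)
    fix k :: nat assume "1 \<le> k"
    show "(if k = 1 then 0 else (2 ^ k - 2) * Gamma (real k) * zeta (real k)) =
      (if k = 1 then 0 else 2 ^ k * Gamma (real k) * dirichlet_eta (real k))"
    proof (cases "k = 1")
      case False
      with \<open>1 \<le> k\<close> have "k \<ge> 2" by simp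
      from dirichlet_eta_eq[OF this] False show ?thesis by (simp add: mult_ac)
    qed simp
  qed
next
  fix m assume m: "m \<in> Poly_Mapping.keys (zeta_bell_poly n)"
  with zeta_bell_poly_coeffs[of n] have nat: "Poly_Mapping.lookup (zeta_bell_poly n) m \<in> \<nat>"
    and V: "Poly_Mapping.keys m \<subseteq> {2..n}"
    by (auto simp: nonneg_int_mpoly_def)
  show "Poly_Mapping.lookup (zeta_bell_poly n) m \<in> \<int>"
    using nat Nats_subset_Ints by blast
  \<comment> \<open>A natural number coefficient at a key is nonzero, hence positive.\<close>
  show "Poly_Mapping.lookup (zeta_bell_poly n) m > 0"
    using nat m by (auto simp: in_keys_iff elim!: Nats_cases)
  show "Poly_Mapping.keys m \<subseteq> {2..n}" by (rule V)
qed

end
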